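(* Let $\mathfrak{G}$ be the Grigorchuk $2$-group and let $(\gamma_n(\mathfrak{G}))_{n\geq 1}$ be its lower central series. Then $$\operatorname{diam}\big(\mathfrak{G}/\gamma_n(\mathfrak{G})\big) = O\big(n^{\log(35)/\log(2)}\big)$$ and $$\operatorname{diam}\big(\mathfrak{G}/\gamma_n(\mathfrak{G})\big) = O\Big(\big(\log|\mathfrak{G}:\gamma_n(\mathfrak{G})|\big)^{\log(35)/\log(2)}\Big),$$ where the implied constants are absolute (independent of $n$).
   Context: Diameter: for a finite group $G$ and a generating set $S\subseteq G$, $B_S(n)$ is the closed ball of radius $n$ about the identity in the word metric of $S$, i.e. the set of products of at most $n$ elements of $S\cup S^{-1}$; $\operatorname{diam}(G,S)=\min\{n\in\mathbb{N}: B_S(n)=G\}$; and $\operatorname{diam}(G)$ is the maximum of $\operatorname{diam}(G,S)$ over all generating sets $S$ of $G$. Lower central series: $\gamma_1(G)=G$ and $\gamma_{n+1}(G)=[\gamma_n(G),G]$. Tree: let $\mathcal{A}=\{0,1\}$ and let $\mathcal{A}^*$ be the set of finite words over $\mathcal{A}$, viewed as the vertex set of the binary rooted tree $\mathcal{T}_2$. $\operatorname{Aut}(\mathcal{T}_2)$ is the group of permutations of $\mathcal{A}^*$ preserving the prefix relation. The Grigorchuk $2$-group $\mathfrak{G}$ is the subgroup of $\operatorname{Aut}(\mathcal{T}_2)$ generated by $a,b,c,d$, defined recursively, for all words $w$, by $a(0w)=1w$, $a(1w)=0w$; $b(0w)=0a(w)$, $b(1w)=1c(w)$; $c(0w)=0a(w)$,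 $c(1w)=1d(w)$; $d(0w)=0w$, $d(1w)=1b(w)$. *)

theory Defs
  imports
    Complex_Main
    "HOL-Algebra.Generated_Groups"
    "HOL-Algebra.Bij"
    "HOL-Library.Sublist"
begin

section \<open>Diameter\<close>

definition word_ball :: "('a, 'b) monoid_scheme \<Rightarrow> 'a set \<Rightarrow> nat \<Rightarrow> 'a set" where
  "word_ball G S n =
    {foldr (\<otimes>\<^bsub>G\<^esub>) ws \<one>\<^bsub>G\<^esub> | ws. set ws \<subseteq> S \<union> set_inv\<^bsub>G\<^esub> S \<and> length ws \<le> n}"

definition diam_wrt :: "('a, 'b) monoid_scheme \<Rightarrow> 'a set \<Rightarrow> nat" where
  "diam_wrt G S = (LEAST n. word_ball G S n = carrier G)"

text \<open>Both \<open>diam_wrt\<close> and \<open>diam\<close> are meaningful only for finite groups: otherwise the set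
  under \<open>LEAST\<close> may be empty, or that under \<open>Max\<close> infinite.\<close>

definition diam :: "('a, 'b) monoid_scheme \<Rightarrow> nat" where
  "diam G = Max {diam_wrt G S | S. S \<subseteq> carrier G \<and> generate G S = carrier G}"


section \<open>Lower central series\<close>

definition commutator_subgroup :: "('a, 'b) monoid_scheme \<Rightarrow> 'a set \<Rightarrow> 'a set \<Rightarrow> 'a set" where
  "commutator_subgroup G H K =
    generate G {h \<otimes>\<^bsub>G\<^esub> k \<otimes>\<^bsub>G\<^esub> inv\<^bsub>G\<^esub> h \<otimes>\<^bsub>G\<^esub> inv\<^bsub>G\<^esub> k | h k. h \<in> H \<and> k \<in> K}"

text \<open>The series is indexed from 1; the value at 0 is a dummy.\<close>

fun lower_central :: "('a, 'b) monoid_scheme \<Rightarrow> nat \<Rightarrow> 'a set" where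
  "lower_central G 0 = carrier G"
| "lower_central G (Suc 0) = carrier G"
| "lower_central G (Suc (Suc n)) =
    commutator_subgroup G (lower_central G (Suc n)) (carrier G)"


section \<open>The Grigorchuk group\<close>

text \<open>The letters 0 and 1 are \<open>False\<close> and \<open>True\<close>.\<close>

definition tree_aut :: "(bool list \<Rightarrow> bool list) monoid" where
  "tree_aut = BijGroup UNIV
    \<lparr>carrier := {f \<in> Bij UNIV. \<forall>u v. prefix (f u) (f v) \<longleftrightarrow> prefix u v}\<rparr>"

fun grig_a :: "bool list \<Rightarrow> bool list" where
  "grig_a [] = []"
| "grig_a (False # w) = True # w"
| "grig_a (True # w) = False # w"

fun grig_b :: "bool list \<Rightarrow> bool list"
  and grig_c :: "bool list \<Rightarrow> bool list"
  and grig_d :: "bool list \<Rightarrow> bool list" where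
  "grig_b [] = []"
| "grig_b (False # w) = False # grig_a w"
| "grig_b (True # w) = True # grig_c w"
| "grig_c [] = []"
| "grig_c (False # w) = False # grig_a w"
| "grig_c (True # w) = True # grig_d w"
| "grig_d [] = []"
| "grig_d (False # w) = False # w"
| "grig_d (True # w) = True # grig_b w"

definition grigorchuk :: "(bool list \<Rightarrow> bool list) monoid" where
  "grigorchuk = tree_aut\<lparr>carrier := generate tree_aut {grig_a, grig_b, grig_c, grig_d}\<rparr>"

lemma subgroup_tree_aut: "subgroup (carrier tree_aut) (BijGroup UNIV)"
proof -
  interpret group "BijGroup (UNIV :: bool list set)" by (rule group_BijGroup)
  show ?thesis
  proof (rule subgroupI)
    show "carrier tree_aut \<subseteq> carrier (BijGroup UNIV)"
      by (auto simp: tree_aut_def BijGroup_def)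
    have "id \<in> carrier tree_aut"
      by (auto simp: tree_aut_def Bij_def)
    then show "carrier tree_aut \<noteq> {}" by blast
  next
    fix f assume f: "f \<in> carrier tree_aut"
    then have B: "f \<in> Bij UNIV" and p: "\<And>u v. prefix (f u) (f v) \<longleftrightarrow> prefix u v"
      by (auto simp: tree_aut_def)
    have "f (inv_into UNIV f x) = x" for x
      using B by (auto simp: Bij_def bij_betw_def intro: f_inv_into_f)
    then have "prefix (inv_into UNIV f u) (inv_into UNIV f v) \<longleftrightarrow> prefix u v" for u v
      by (metis p)
    then show "inv\<^bsub>BijGroup UNIV\<^esub> f \<in> carrier tree_aut"
      using B restrict_inv_into_Bij[OF B] by (simp add: inv_BijGroup tree_aut_def)
  next
    fix f g assume "f \<in> carrier tree_aut" "g \<in> carrier tree_aut"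
    then show "f \<otimes>\<^bsub>BijGroup UNIV\<^esub> g \<in> carrier tree_aut"
      using compose_Bij[of f UNIV g] by (auto simp: tree_aut_def BijGroup_def compose_def)
  qed
qed

lemma group_tree_aut: "group tree_aut"
proof -
  have "tree_aut = BijGroup UNIV\<lparr>carrier := carrier tree_aut\<rparr>"
    by (simp add: tree_aut_def)
  then show ?thesis
    using group.subgroup_imp_group[OF group_BijGroup subgroup_tree_aut] by simp
qed

lemma grig_a_grig_a [simp]: "grig_a (grig_a w) = w"
  by (cases w rule: grig_a.cases) auto

lemma grig_bcd_involutive [simp]:
  "grig_b (grig_b w) = w" "grig_c (grig_c w) = w" "grig_d (grig_d w) = w"
  by (induction w rule: grig_b_grig_c_grig_d.induct) auto

lemma prefix_grig_a [simp]: "prefix (grig_a u) (grig_a v) \<longleftrightarrow> prefix u v"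
  by (cases u rule: grig_a.cases; cases v rule: grig_a.cases) auto

lemma prefix_grig_bcd [simp]:
  "prefix (grig_b u) (grig_b v) \<longleftrightarrow> prefix u v"
  "prefix (grig_c u) (grig_c v) \<longleftrightarrow> prefix u v"
  "prefix (grig_d u) (grig_d v) \<longleftrightarrow> prefix u v"
proof (induction u arbitrary: v and v and v rule: grig_b_grig_c_grig_d.induct)
  case (2 w) then show ?case by (cases v rule: grig_a.cases) auto
next
  case (3 w) then show ?case by (cases v rule: grig_a.cases) auto
next
  case (5 w) then show ?case by (cases v rule: grig_a.cases) auto
next
  case (6 w) then show ?case by (cases v rule: grig_a.cases) auto
next
  case (8 w) then show ?case by (cases v rule: grig_a.cases) auto
next
  case (9 w) then show ?case by (cases v rule: grig_a.cases) auto
qed auto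

lemma grig_generators_in_tree_aut: "{grig_a, grig_b, grig_c, grig_d} \<subseteq> carrier tree_aut"
proof -
  have "bij grig_a" "bij grig_b" "bij grig_c" "bij grig_d"
    by (rule involuntory_imp_bij, simp)+
  then show ?thesis
    by (simp add: tree_aut_def Bij_def)
qed

lemma group_grigorchuk: "group grigorchuk"
  unfolding grigorchuk_def
  using group.subgroup_imp_group[OF group_tree_aut]
    group.generate_is_subgroup[OF group_tree_aut grig_generators_in_tree_aut] by blast

end

theory Submission
  imports Defs
begin

text \<open>
Let \<open>K\<close> be the normal closure of \<open>t = (ab)\<^sup>2\<close> in the Grigorchuk group \<open>G\<close>. It is a branching
subgroup: \<open>K \<times> K\<close>, acting on the two subtrees below the root, lies in \<open>K\<close>. Let \<open>K\<^sub>n\<close> be the product of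
\<open>2\<^sup>n\<close> copies of \<open>K\<close> acting below the vertices of level \<open>n\<close>. The \<open>K\<^sub>n\<close> form a decreasing chain of normal
subgroups of finite index. Diameters are bounded along this chain, and the chain is compared with
the lower central series.
In the formal text \<open>G\<close>, \<open>K\<close>, \<open>K\<^sub>n\<close>, \<open>\<gamma>\<^sub>n\<close>, \<open>(x,y)\<close>, \<open>[x,y]\<close>, \<open>x\<^sup>g\<close> are \<open>GG\<close>, \<open>KK\<close>, \<open>KL n\<close>, \<open>gamma n\<close>, \<open>pr x y\<close>,
\<open>comm x y\<close>, \<open>cj g x\<close>.

\<^bold>\<open>Short words.\<close> The argument is of Solovay--Kitaev type. The group \<open>K\<close> is abelian modulo \<open>K\<^sub>2\<close>
(\<open>KK_abelian_mod_KL_2\<close>), \<open>K/K\<^sub>1\<close> is cyclic, generated by \<open>t\<close> and killed by 4, and \<open>t\<close> acts as \<open>ca\<close> and as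
\<open>ac\<close> on the two subtrees. Conjugation by \<open>ca\<close> sends \<open>(x,y)\<close> in \<open>K\<^sub>1/K\<^sub>2\<close> to \<open>(y,-x)\<close>, so it is a
square root \<open>i\<close> of \<open>-1\<close>; hence \<open>\<phi>(x) = [x,ca]\<close> is multiplication by \<open>i - 1\<close> and \<open>\<phi>\<^sup>4 = -4 = 0\<close> there
(\<open>nil4_ca\<close>), while \<open>\<phi>\<close> maps \<open>K\<close> onto \<open>K\<^sub>1\<close> modulo \<open>K\<^sub>2\<close> (\<open>onto_ca\<close>). Both facts hold in every
coordinate of level \<open>n\<close> at once. So let \<open>s\<close> agree modulo \<open>K\<^bsub>n+1\<^esub>\<close> with the element having \<open>t\<close> at all
vertices of level \<open>n\<close>. An element \<open>z\<close> of \<open>K\<^bsub>n+2\<^esub>\<close> is \<open>[f,s]\<close> modulo \<open>K\<^bsub>n+3\<^esub>\<close> with \<open>f\<close> in \<open>K\<^bsub>n+1\<^esub>\<close>. If a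
short word only gives \<open>f\<close> up to an error \<open>e\<close> in \<open>K\<^bsub>n+2\<^esub>\<close>, then \<open>[e,s]\<close> is still missing; but \<open>e\<close> is
itself some \<open>[f',s]\<close>, so what is missing is \<open>[[f',s],s]\<close>, which is approximated in the same way.
After four rounds nothing is missing (\<open>commutator_approximation\<close>). An \<open>i\<close>-fold commutator has
\<open>2\<^sup>i\<close> letters \<open>f\<close> and \<open>2\<^bsup>i+1\<^esup> - 2\<close> letters \<open>s\<close>, in total 30 and 52, and \<open>30 * 35 + 52 \<le> 35\<^sup>2\<close>. By induction
\<open>C * 35\<^sup>n\<close> letters of any generating set reach every coset of \<open>K\<^sub>n\<close>, with \<open>C\<close> independent of
the generating set (\<open>uniform_approximation\<close>).

\<^bold>\<open>Depth in the lower central series.\<close> One has \<open>t\<^sup>4 = b\<close> at all vertices of level 3. Starting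
from \<open>t\<^sup>4\<close> at one vertex of level \<open>m\<close>, each further commutator with one of the four generators
moves, up to conjugation, one step along an explicit sequence that ends, after \<open>2\<^sup>m - 1\<close> steps, at \<open>t\<^sup>4\<close> at all vertices of
level \<open>m\<close>, that is, \<open>b\<close> at all vertices of level \<open>m + 3\<close> (\<open>chain_in_gamma\<close>). One more commutator
produces \<open>[b,a] = t\<^sup>-\<^sup>1\<close> at a single vertex of level \<open>m + 3\<close>, whose normal closure is \<open>K\<^bsub>m+3\<^esub>\<close>.
Thus \<open>K\<^sub>m \<le> \<gamma>\<^sub>k\<close> implies \<open>K\<^bsub>m+3\<^esub> \<le> \<gamma>\<^bsub>k+2^m\<^esub>\<close>, and \<open>K\<^bsub>3k\<^esub> \<le> \<gamma>\<^sub>n\<close> as soon as \<open>n\<close> is at most about \<open>8\<^sup>k/8\<close>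
(\<open>KL_subset_gamma\<close>). With \<open>n\<close> of size \<open>8\<^sup>k\<close> this gives \<open>35\<^bsup>3k\<^esup> = (8\<^sup>k)\<^bsup>log 35 / log 2\<^esup>\<close> letters.

\<^bold>\<open>Index.\<close> The series \<open>\<gamma>\<^sub>n\<close> decreases strictly (\<open>gamma_strict\<close>), so the index of \<open>\<gamma>\<^sub>n\<close> is at least
\<open>2\<^bsup>n-1\<^esup>\<close> and \<open>n\<close> is at most a constant times its logarithm when \<open>n \<ge> 2\<close>.
\<close>

section \<open>Tree automorphisms as an additive group\<close>


text \<open>As a type, the tree automorphisms form a group in the sense of the class \<open>group_add\<close>, which
does not require commutativity. This removes all carrier conditions from computations with words,
at the price of additive notation: \<open>x + y\<close> is the composition, \<open>- x\<close> the inverse.\<close>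

typedef taut = "{f :: bool list \<Rightarrow> bool list. bij f \<and> (\<forall>u v. prefix (f u) (f v) \<longleftrightarrow> prefix u v)}"
  morphisms act Taut
  by (rule exI[of _ id]) auto

setup_lifting type_definition_taut

instantiation taut :: group_add
begin

lift_definition zero_taut :: taut is id by simp

lift_definition plus_taut :: "taut \<Rightarrow> taut \<Rightarrow> taut" is comp by (auto intro: bij_comp)

lift_definition uminus_taut :: "taut \<Rightarrow> taut" is "inv_into UNIV"
proof -
  fix f :: "bool list \<Rightarrow> bool list"
  assume f: "bij f \<and> (\<forall>u v. prefix (f u) (f v) \<longleftrightarrow> prefix u v)"
  then have "prefix (inv_into UNIV f u) (inv_into UNIV f v) \<longleftrightarrow> prefix u v" for u v
    by (metis bij_inv_eq_iff)
  with f show "bij (inv_into UNIV f) \<and> (\<forall>u v. prefix (inv_into UNIV f u) (inv_into UNIV f v) \<longleftrightarrow> prefix u v)"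
    by (simp add: bij_imp_bij_inv)
qed

definition minus_taut :: "taut \<Rightarrow> taut \<Rightarrow> taut" where "minus_taut x y = x + - y"

instance
proof
  fix x y z :: taut
  show "x + y + z = x + (y + z)" by transfer (simp add: comp_assoc)
  show "0 + x = x" by transfer simp
  show "x + 0 = x" by transfer simp
  show "- x + x = 0" by transfer (simp add: bij_is_inj)
  show "x + - y = x - y" by (simp add: minus_taut_def)
qed

end

text \<open>With sums written as \<open>x + - y\<close> and bracketed to the right, the simplifier decides the word
problem of a free group.\<close>

declare add_uminus_conv_diff [simp del] diff_conv_add_uminus [simp]
declare minus_add [simp]

lemma act_plus [simp]: "act (x + y) w = act x (act y w)"
  by (simp add: plus_taut.rep_eq)

lemma act_zero [simp]: "act 0 w = w"
  by (simp add: zero_taut.rep_eq)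

lemma taut_eqI: "(\<And>w. act x w = act y w) \<Longrightarrow> x = y"
  by (simp add: act_inject[symmetric] ext)

fun pair_fun :: "(bool list \<Rightarrow> bool list) \<Rightarrow> (bool list \<Rightarrow> bool list) \<Rightarrow> bool list \<Rightarrow> bool list" where
  "pair_fun f g [] = []"
| "pair_fun f g (False # w) = False # f w"
| "pair_fun f g (True # w) = True # g w"

lift_definition pr :: "taut \<Rightarrow> taut \<Rightarrow> taut" is pair_fun
proof -
  fix f g :: "bool list \<Rightarrow> bool list"
  assume f: "bij f \<and> (\<forall>u v. prefix (f u) (f v) \<longleftrightarrow> prefix u v)"
    and g: "bij g \<and> (\<forall>u v. prefix (g u) (g v) \<longleftrightarrow> prefix u v)"
  have "bij (pair_fun f g)"
  proof (rule o_bij)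
    show "pair_fun (inv_into UNIV f) (inv_into UNIV g) \<circ> pair_fun f g = id"
    proof
      fix w show "(pair_fun (inv_into UNIV f) (inv_into UNIV g) \<circ> pair_fun f g) w = id w"
        using f g by (cases w rule: grig_a.cases) (auto simp: bij_is_inj)
    qed
    show "pair_fun f g \<circ> pair_fun (inv_into UNIV f) (inv_into UNIV g) = id"
    proof
      fix w show "(pair_fun f g \<circ> pair_fun (inv_into UNIV f) (inv_into UNIV g)) w = id w"
        using f g by (cases w rule: grig_a.cases) (auto simp: bij_is_surj surj_f_inv_f)
    qed
  qed
  moreover have "prefix (pair_fun f g u) (pair_fun f g v) \<longleftrightarrow> prefix u v" for u v
    using f g by (cases u rule: grig_a.cases; cases v rule: grig_a.cases) auto
  ultimately show "bij (pair_fun f g) \<and>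
      (\<forall>u v. prefix (pair_fun f g u) (pair_fun f g v) \<longleftrightarrow> prefix u v)"
    by blast
qed

lift_definition a :: taut is grig_a by (auto intro: involuntory_imp_bij)
lift_definition b :: taut is grig_b by (auto intro: involuntory_imp_bij)
lift_definition c :: taut is grig_c by (auto intro: involuntory_imp_bij)
lift_definition d :: taut is grig_d by (auto intro: involuntory_imp_bij)

lemma act_pr [simp]:
  "act (pr x y) [] = []" "act (pr x y) (False # w) = False # act x w"
  "act (pr x y) (True # w) = True # act y w"
  by (simp_all add: pr.rep_eq)

lemma act_a [simp]: "act a [] = []" "act a (False # w) = True # w" "act a (True # w) = False # w"
  by (simp_all add: a.rep_eq)

lemma taut_word_eqI:
  assumes "act x [] = act y []" "\<And>w. act x (False # w) = act y (False # w)"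
    "\<And>w. act x (True # w) = act y (True # w)"
  shows "x = y"
  by (metis assms grig_a.cases taut_eqI)

lemma pr_plus [simp]: "pr x y + pr x' y' = pr (x + x') (y + y')"
  by (rule taut_word_eqI) simp_all

lemma pr_plus_left [simp]: "pr x y + (pr x' y' + z) = pr (x + x') (y + y') + z"
  by (simp flip: add.assoc)

lemma pr_zero [simp]: "pr 0 0 = 0"
  by (rule taut_word_eqI) simp_all

lemma pr_uminus [simp]: "- pr x y = pr (- x) (- y)"
  by (rule minus_unique) simp

lemma pr_eq_iff [simp]: "pr x y = pr x' y' \<longleftrightarrow> x = x' \<and> y = y'"
  by (metis act_pr(2,3) list.inject taut_eqI)

lemma pr_eq_0_iff [simp]: "pr x y = 0 \<longleftrightarrow> x = 0 \<and> y = 0"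
  by (metis pr_eq_iff pr_zero)

lemma a_neq_pr: "pr x y \<noteq> pr x' y' + a"
  by (metis act_a(2) act_plus act_pr(2,3) list.inject)

lemma a_pr [simp]: "a + pr x y = pr y x + a"
  by (rule taut_word_eqI) simp_all

lemma a_pr_left [simp]: "a + (pr x y + z) = pr y x + (a + z)"
  by (metis a_pr add.assoc)

lemma b_pr: "b = pr a c"
  by (rule taut_word_eqI) (simp_all add: a.rep_eq b.rep_eq c.rep_eq pr.rep_eq)

lemma c_pr: "c = pr a d"
  by (rule taut_word_eqI) (simp_all add: a.rep_eq d.rep_eq c.rep_eq pr.rep_eq)

lemma d_pr: "d = pr 0 b"
  by (rule taut_word_eqI) (simp_all add: b.rep_eq d.rep_eq pr.rep_eq zero_taut.rep_eq)

lemma grig_bcd: "grig_b (grig_c w) = grig_d w \<and> grig_c (grig_d w) = grig_b w \<and> grig_d (grig_b w) = grig_c w"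
  by (induction w rule: grig_b_grig_c_grig_d.induct(1)[where Q = "\<lambda>w. grig_b (grig_c w) = grig_d w \<and> grig_c (grig_d w) = grig_b w \<and> grig_d (grig_b w) = grig_c w" and R = "\<lambda>w. grig_b (grig_c w) = grig_d w \<and> grig_c (grig_d w) = grig_b w \<and> grig_d (grig_b w) = grig_c w"]) auto

lemma gen_double [simp]: "a + a = 0" "b + b = 0" "c + c = 0" "d + d = 0"
  by (rule taut_eqI; simp add: a.rep_eq b.rep_eq c.rep_eq d.rep_eq)+

lemma klein_four [simp]:
  "b + c = d" "c + b = d" "b + d = c" "d + b = c" "c + d = b" "d + c = b"
proof -
  show bc: "b + c = d" and cd: "c + d = b" and db: "d + b = c"
    by (rule taut_eqI; simp add: b.rep_eq c.rep_eq d.rep_eq grig_bcd)+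
  show "c + b = d" "d + c = b" "b + d = c"
    by (metis add.assoc bc cd db gen_double add_0 add_0_right)+
qed

lemma gen_uminus [simp]: "- a = a" "- b = b" "- c = c" "- d = d"
  by (simp_all add: minus_unique)

text \<open>Together with associativity these rules bring every word in the generators to its normal form
in the free product of \<open>{1, a}\<close> and the Klein four-group \<open>{1, b, c, d}\<close>.\<close>

lemma gen_left [simp]:
  "a + (a + x) = x" "b + (b + x) = x" "c + (c + x) = x" "d + (d + x) = x"
  "b + (c + x) = d + x" "c + (b + x) = d + x" "b + (d + x) = c + x"
  "d + (b + x) = c + x" "c + (d + x) = b + x" "d + (c + x) = b + x"
  by (simp_all flip: add.assoc)

section \<open>Subgroups, congruences, conjugation and commutators in additive notation\<close>

definition cj :: "'a::group_add \<Rightarrow> 'a \<Rightarrow> 'a" where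
  "cj g x = - g + x + g"

definition comm :: "'a::group_add \<Rightarrow> 'a \<Rightarrow> 'a" where
  "comm x y = - x + - y + x + y"

definition subgp :: "'a::group_add set \<Rightarrow> bool" where
  "subgp H \<longleftrightarrow> 0 \<in> H \<and> (\<forall>x\<in>H. \<forall>y\<in>H. x + y \<in> H) \<and> (\<forall>x\<in>H. - x \<in> H)"

definition normalized_by :: "'a::group_add set \<Rightarrow> 'a set \<Rightarrow> bool" where
  "normalized_by N H \<longleftrightarrow> (\<forall>x\<in>N. \<forall>g\<in>H. cj g x \<in> N)"

inductive_set gen :: "'a::group_add set \<Rightarrow> 'a set" for S where
  gen_zero: "0 \<in> gen S"
| gen_base: "x \<in> S \<Longrightarrow> x \<in> gen S"
| gen_plus: "x \<in> gen S \<Longrightarrow> y \<in> gen S \<Longrightarrow> x + y \<in> gen S"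
| gen_minus: "x \<in> gen S \<Longrightarrow> - x \<in> gen S"

lemma subgpI:
  assumes "0 \<in> H" "\<And>x y. x \<in> H \<Longrightarrow> y \<in> H \<Longrightarrow> x + y \<in> H" "\<And>x. x \<in> H \<Longrightarrow> - x \<in> H"
  shows "subgp H"
  using assms by (simp add: subgp_def)

lemma subgpD:
  assumes "subgp H"
  shows "0 \<in> H" "\<And>x y. x \<in> H \<Longrightarrow> y \<in> H \<Longrightarrow> x + y \<in> H" "\<And>x. x \<in> H \<Longrightarrow> - x \<in> H"
  using assms by (simp_all add: subgp_def)

lemma normalized_byI: "(\<And>x g. x \<in> N \<Longrightarrow> g \<in> H \<Longrightarrow> cj g x \<in> N) \<Longrightarrow> normalized_by N H"
  by (simp add: normalized_by_def)

lemma normalized_byD: "normalized_by N H \<Longrightarrow> x \<in> N \<Longrightarrow> g \<in> H \<Longrightarrow> cj g x \<in> N"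
  by (simp add: normalized_by_def)

lemma subgp_gen: "subgp (gen S)"
  by (rule subgpI) (auto intro: gen.intros)

lemma gen_least: "subgp H \<Longrightarrow> S \<subseteq> H \<Longrightarrow> gen S \<subseteq> H"
proof
  fix x assume H: "subgp H" "S \<subseteq> H" and "x \<in> gen S"
  from this(3) show "x \<in> H" by (induction) (use H subgpD[OF H(1)] in auto)
qed

lemma cj_simps [simp]:
  "cj 0 x = x" "cj g 0 = (0::'a::group_add)" "cj g (x + y) = cj g x + cj g y"
  "cj g (- x) = - cj g x" "cj (g + h) x = cj h (cj g x)" "cj (- g) (cj g x) = x"
  "cj g (cj (- g) x) = x" "cj g g = g"
  by (simp_all add: cj_def add.assoc)

lemma cj_pr [simp]: "cj (pr g h) (pr x y) = pr (cj g x) (cj h y)"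
  by (simp add: cj_def add.assoc)

lemma cj_a_pr [simp]: "cj a (pr x y) = pr y x"
  by (simp add: cj_def add.assoc)

lemma comm_pr [simp]: "comm (pr x y) (pr g h) = pr (comm x g) (comm y h)"
  by (simp add: comm_def add.assoc)

lemma comm_cj: "comm x g = - x + cj g x"
  by (simp add: comm_def cj_def add.assoc)

lemma uminus_comm: "- comm x y = comm y x"
  by (simp add: comm_def add.assoc)

lemma cj_comm: "cj g (comm x y) = comm (cj g x) (cj g y)"
  by (simp add: comm_def)

lemma comm_zero [simp]: "comm 0 g = 0" "comm x 0 = 0" "comm x x = (0::'a::group_add)"
  by (simp_all add: comm_def add.assoc)

lemma comm_plus_left: "comm (x + y) g = cj y (comm x g) + comm y g"
  by (simp add: comm_def cj_def add.assoc)

lemma comm_plus_right: "comm x (g + h) = comm x h + cj h (comm x g)"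
  by (simp add: comm_def cj_def add.assoc)

lemma comm_uminus_left: "comm (- x) g = - cj (- x) (comm x g)"
  by (simp add: comm_def cj_def add.assoc)

lemma comm_in: "subgp H \<Longrightarrow> x \<in> H \<Longrightarrow> y \<in> H \<Longrightarrow> comm x y \<in> H"
  unfolding comm_def by (intro subgpD) auto

lemma cj_in: "subgp H \<Longrightarrow> x \<in> H \<Longrightarrow> y \<in> H \<Longrightarrow> cj x y \<in> H"
  unfolding cj_def by (intro subgpD) auto

lemma comm_in_normalized:
  "subgp N \<Longrightarrow> normalized_by N H \<Longrightarrow> x \<in> N \<Longrightarrow> g \<in> H \<Longrightarrow> comm x g \<in> N"
  unfolding comm_cj by (intro subgpD normalized_byD) auto

lemma normalized_by_gen:
  assumes "\<And>x g. x \<in> N \<Longrightarrow> g \<in> S \<Longrightarrow> cj g x \<in> N \<and> cj (- g) x \<in> N"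
  shows "normalized_by N (gen S)"
proof (rule normalized_byI)
  fix x g assume "x \<in> N" "g \<in> gen S"
  from this(2,1) have "cj g x \<in> N \<and> cj (- g) x \<in> N"
    by (induction arbitrary: x) (use assms in auto)
  then show "cj g x \<in> N" ..
qed

lemma normalized_gen:
  assumes "\<And>x g. x \<in> S \<Longrightarrow> g \<in> H \<Longrightarrow> cj g x \<in> gen S"
  shows "normalized_by (gen S) H"
proof (rule normalized_byI)
  fix x g assume "x \<in> gen S" "g \<in> H"
  then show "cj g x \<in> gen S"
    by (induction) (use assms in \<open>auto intro: gen.intros\<close>)
qed

definition cong_mod :: "'a::group_add set \<Rightarrow> 'a \<Rightarrow> 'a \<Rightarrow> bool" where
  "cong_mod N x y \<longleftrightarrow> - x + y \<in> N"

lemma cong_refl: "subgp N \<Longrightarrow> cong_mod N x x"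
  by (simp add: cong_mod_def subgpD)

lemma cong_sym: "subgp N \<Longrightarrow> cong_mod N x y \<Longrightarrow> cong_mod N y x"
  unfolding cong_mod_def using subgpD(3)[of N "- x + y"] by (simp add: minus_minus)

lemma cong_trans: "subgp N \<Longrightarrow> cong_mod N x y \<Longrightarrow> cong_mod N y z \<Longrightarrow> cong_mod N x z"
  unfolding cong_mod_def using subgpD(2)[of N "- x + y" "- y + z"] by (simp add: add.assoc)

lemma cong_plus:
  assumes "subgp N" "normalized_by N H" "y \<in> H" "cong_mod N x x'" "cong_mod N y y'"
  shows "cong_mod N (x + y) (x' + y')"
proof -
  have "cj y (- x + x') \<in> N"
    using normalized_byD[OF assms(2) _ assms(3)] assms(4) unfolding cong_mod_def by blast
  then have "cj y (- x + x') + (- y + y') \<in> N"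
    using assms(1,5) unfolding cong_mod_def by (blast intro: subgpD)
  then show ?thesis by (simp add: cong_mod_def cj_def add.assoc)
qed

lemma cong_cj:
  assumes "normalized_by N H" "g \<in> H" "cong_mod N x y"
  shows "cong_mod N (cj g x) (cj g y)"
  using normalized_byD[OF assms(1) _ assms(2), of "- x + y"] assms(3) by (simp add: cong_mod_def)

lemma cong_uminus:
  assumes "subgp N" "normalized_by N H" "- x \<in> H" "cong_mod N x y"
  shows "cong_mod N (- x) (- y)"
proof -
  have "cj (- x) (- (- x + y)) \<in> N"
    using assms(1,4) unfolding cong_mod_def
    by (blast intro: subgpD normalized_byD[OF assms(2) _ assms(3)])
  then show ?thesis by (simp add: cong_mod_def cj_def add.assoc)
qed

lemma cong_mem: "subgp H \<Longrightarrow> N \<subseteq> H \<Longrightarrow> cong_mod N x y \<Longrightarrow> y \<in> H \<Longrightarrow> x \<in> H"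
proof -
  assume H: "subgp H" "N \<subseteq> H" "cong_mod N x y" "y \<in> H"
  then have "y + - (- x + y) \<in> H" by (auto simp: cong_mod_def simp del: minus_add intro: subgpD)
  then show "x \<in> H" by simp
qed

lemma cong_mono: "cong_mod N x y \<Longrightarrow> N \<subseteq> M \<Longrightarrow> cong_mod M x y"
  by (auto simp: cong_mod_def)


section \<open>The Grigorchuk group and its self-similarity\<close>

definition GG :: "taut set" where
  "GG = gen {a, b, c, d}"

lemma subgp_GG: "subgp GG"
  by (simp add: GG_def subgp_gen)

lemma gens_in_GG [simp]: "a \<in> GG" "b \<in> GG" "c \<in> GG" "d \<in> GG"
  by (simp_all add: GG_def gen_base)

text \<open>Inverses need no case, because the generators are involutions.\<close>

lemma GG_induct [consumes 1, case_names gen plus]: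
  assumes "x \<in> GG" "\<And>g. g \<in> {a, b, c, d} \<Longrightarrow> P g"
    "\<And>x y. x \<in> GG \<Longrightarrow> y \<in> GG \<Longrightarrow> P x \<Longrightarrow> P y \<Longrightarrow> P (x + y)"
  shows "P x"
proof -
  have "x \<in> GG \<and> - x \<in> GG \<and> P x \<and> P (- x)"
    using assms(1)[unfolded GG_def]
  proof (induction)
    case gen_zero
    then show ?case using assms(2)[of a] assms(3)[of a a] subgpD[OF subgp_GG]
      by (simp add: minus_zero)
  next
    case (gen_base x)
    then show ?case using assms(2)[of x] by (auto)
  next
    case (gen_plus x y)
    then show ?case using assms(3) subgpD[OF subgp_GG] by simp
  next
    case (gen_minus x)
    then show ?case by (simp add: minus_minus)
  qed
  then show ?thesis by simp
qed

text \<open>The generator \<open>c = bd\<close> comes for free.\<close>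

lemma normalized_by_GG:
  assumes "\<And>x. x \<in> N \<Longrightarrow> cj a x \<in> N" "\<And>x. x \<in> N \<Longrightarrow> cj b x \<in> N" "\<And>x. x \<in> N \<Longrightarrow> cj d x \<in> N"
  shows "normalized_by N GG"
  unfolding GG_def
proof (rule normalized_by_gen)
  fix x g assume x: "x \<in> N" and "g \<in> {a, b, c, d}"
  moreover have "cj c x \<in> N"
    using assms(3)[OF assms(2)[OF x]] by (simp del: cj_simps add: cj_simps(5)[symmetric])
  ultimately show "cj g x \<in> N \<and> cj (- g) x \<in> N"
    using assms(1)[OF x] assms(2)[OF x] assms(3)[OF x] by (elim insertE emptyE) simp_all
qed

text \<open>Self-replication: \<open>c\<close>, \<open>ada\<close>, \<open>aba\<close>, \<open>aca\<close> have left sections \<open>a\<close>, \<open>b\<close>, \<open>c\<close>, \<open>d\<close>. Hence conjugation inside \<open>G\<close>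
realizes every conjugation of \<open>G\<close> on the left subtree.\<close>

lemma self_replicating: "g \<in> GG \<Longrightarrow> \<exists>y\<in>GG. pr g y \<in> GG"
proof (induction rule: GG_induct)
  case (gen g)
  have "cj a b = pr c a" "cj a c = pr d a" "cj a d = pr b 0" "c = pr a d"
    by (rule cj_a_pr[of a c, folded b_pr] cj_a_pr[of a d, folded c_pr]
        cj_a_pr[of 0 b, folded d_pr] c_pr)+
  moreover have "cj a b \<in> GG" "cj a c \<in> GG" "cj a d \<in> GG" "c \<in> GG"
    by (rule cj_in[OF subgp_GG] gens_in_GG)+
  ultimately have "pr a d \<in> GG" "pr b 0 \<in> GG" "pr c a \<in> GG" "pr d a \<in> GG"
    by simp_all
  then show ?case using gen gens_in_GG subgpD(1)[OF subgp_GG] by blast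
next
  case (plus x y)
  then show ?case
    by (metis pr_plus subgpD(2)[OF subgp_GG])
qed

lemma GG_cases:
  assumes "g \<in> GG"
  obtains x y where "x \<in> GG" "y \<in> GG" "g = pr x y" | x y where "x \<in> GG" "y \<in> GG" "g = pr x y + a"
proof -
  have "\<exists>x\<in>GG. \<exists>y\<in>GG. g = pr x y \<or> g = pr x y + a"
    using assms
  proof (induction rule: GG_induct)
    case (gen g)
    have "a = pr 0 0 + a" by simp
    then show ?case using gen b_pr c_pr d_pr gens_in_GG subgpD(1)[OF subgp_GG] by blast
  next
    case (plus g h)
    then obtain x y x' y' where mem: "x \<in> GG" "y \<in> GG" "x' \<in> GG" "y' \<in> GG"
      and "g = pr x y \<or> g = pr x y + a" "h = pr x' y' \<or> h = pr x' y' + a" by blast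
    then have "g + h = pr (x + x') (y + y') \<or> g + h = pr (x + x') (y + y') + a \<or>
      g + h = pr (x + y') (y + x') \<or> g + h = pr (x + y') (y + x') + a"
      by (auto simp: add.assoc)
    then show ?case using mem subgpD(2)[OF subgp_GG] by blast
  qed
  with that show thesis by blast
qed

section \<open>Groups acting below a level of the tree\<close>

text \<open>\<open>lvl n X\<close> consists of the automorphisms that fix level \<open>n\<close> and act by elements of \<open>X\<close> below each of its
vertices; \<open>diag n x\<close> acts by \<open>x\<close> below all of them.\<close>

primrec lvl :: "nat \<Rightarrow> taut set \<Rightarrow> taut set" where
  "lvl 0 X = X"
| "lvl (Suc n) X = {pr x y | x y. x \<in> lvl n X \<and> y \<in> lvl n X}"

primrec diag :: "nat \<Rightarrow> taut \<Rightarrow> taut" where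
  "diag 0 x = x"
| "diag (Suc n) x = pr (diag n x) (diag n x)"

lemma pr_in_lvl [simp]: "pr x y \<in> lvl (Suc n) X \<longleftrightarrow> x \<in> lvl n X \<and> y \<in> lvl n X"
  by auto

lemma lvl_add: "lvl (m + n) X = lvl m (lvl n X)"
  by (induction m) simp_all

lemma lvl_mono: "X \<subseteq> Y \<Longrightarrow> lvl n X \<subseteq> lvl n Y"
  by (induction n) auto

lemma diag_in_lvl: "x \<in> X \<Longrightarrow> diag n x \<in> lvl n X"
  by (induction n) simp_all

lemma diag_add: "diag (m + n) x = diag m (diag n x)"
  by (induction m) simp_all

lemma subgp_lvl: "subgp X \<Longrightarrow> subgp (lvl n X)"
proof (induction n)
  case (Suc n)
  then have IH: "subgp (lvl n X)" by simp
  show ?case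
  proof (rule subgpI)
    show "0 \<in> lvl (Suc n) X" using subgpD(1)[OF IH] pr_in_lvl pr_zero by metis
  qed (use subgpD[OF IH] in auto)
qed simp

lemma normalized_lvl: "normalized_by X GG \<Longrightarrow> normalized_by (lvl n X) GG"
proof (induction n)
  case (Suc n)
  then have IH: "normalized_by (lvl n X) GG" by simp
  have D: "cj b (pr x y) = pr (cj a x) (cj c y)" "cj d (pr x y) = pr x (cj b y)" for x y
    by (simp_all add: b_pr[THEN arg_cong, of "\<lambda>z. cj z (pr x y)"] d_pr[THEN arg_cong, of "\<lambda>z. cj z (pr x y)"])
  show ?case
    by (rule normalized_by_GG) (use normalized_byD[OF IH] D in auto)
qed simp

lemma lvl_comm: "(\<And>x y. x \<in> X \<Longrightarrow> y \<in> Y \<Longrightarrow> comm x y \<in> Z) \<Longrightarrow>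
  x \<in> lvl n X \<Longrightarrow> y \<in> lvl n Y \<Longrightarrow> comm x y \<in> lvl n Z"
  by (induction n arbitrary: x y) auto

text \<open>What a normalized subgroup contains on the left subtree is again a normalized subgroup, by
self-replication. This allows induction on the level: a normalized subgroup that contains \<open>lvl n X\<close> on
the left subtree also contains its conjugate under \<open>a\<close>, hence all of \<open>lvl (Suc n) X\<close>.\<close>

lemma left_section_subgroup:
  assumes "subgp N" "normalized_by N GG"
  shows "subgp {x. pr x 0 \<in> N}" "normalized_by {x. pr x 0 \<in> N} GG"
proof -
  show "subgp {x. pr x 0 \<in> N}"
  proof (rule subgpI; clarsimp)
    show "0 \<in> N" using assms(1) by (rule subgpD)
    show "pr (x + y) 0 \<in> N" if "pr x 0 \<in> N" "pr y 0 \<in> N" for x y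
      using subgpD(2)[OF assms(1) that] by simp
    show "pr (- x) 0 \<in> N" if "pr x 0 \<in> N" for x
      using subgpD(3)[OF assms(1) that] by (simp add: minus_zero)
  qed
  show "normalized_by {x. pr x 0 \<in> N} GG"
  proof (rule normalized_byI; clarsimp)
    fix x g assume "pr x 0 \<in> N" "g \<in> GG"
    moreover from this(2) obtain y where "pr g y \<in> GG" using self_replicating by blast
    ultimately show "pr (cj g x) 0 \<in> N"
      using normalized_byD[OF assms(2), of "pr x 0" "pr g y"] by simp
  qed
qed

lemma lvl_Suc_subset_of_left:
  assumes "subgp N" "normalized_by N GG" "lvl n X \<subseteq> {x. pr x 0 \<in> N}"
  shows "lvl (Suc n) X \<subseteq> N"
proof
  fix z assume "z \<in> lvl (Suc n) X"
  then obtain x y where z: "z = pr x y" "pr x 0 \<in> N" "pr y 0 \<in> N"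
    using assms(3) by auto
  have "pr 0 y \<in> N" using normalized_byD[OF assms(2) z(3), of a] by simp
  then have "pr x 0 + pr 0 y \<in> N" using subgpD(2)[OF assms(1) z(2)] by blast
  then show "z \<in> N" using z(1) by simp
qed

section \<open>The branching subgroup\<close>

definition t :: taut where
  "t = a + b + a + b"

lemma t_pr: "t = pr (c + a) (a + c)"
proof -
  have "t = cj a b + b" by (simp add: t_def cj_def)
  also have "\<dots> = pr (c + a) (a + c)" by (subst (1 2) b_pr) simp
  finally show ?thesis .
qed

text \<open>The last equation is the source of branching: a normal subgroup containing \<open>t\<close> contains the
commutator of \<open>t\<close> and \<open>d\<close>, which acts on one subtree only.\<close>

lemma cj_t: "cj a t = - t" "cj b t = - t" "cj d t = t + pr 0 (cj c t)"
proof -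
  show "cj a t = - t" "cj b t = - t"
    by (simp_all add: cj_def t_def add.assoc)
  have "cj b (a + c) = a + c + cj c t"
    by (simp add: cj_def t_def add.assoc)
  then have "cj (pr 0 b) (pr (c + a) (a + c)) = pr (c + a) (a + c) + pr 0 (cj c t)"
    by (simp del: cj_simps add: cj_simps(1))
  then show "cj d t = t + pr 0 (cj c t)"
    by (simp only: t_pr[symmetric] d_pr[symmetric])
qed

lemma t_nonzero: "t \<noteq> 0"
proof
  assume "t = 0"
  then have "a + c = 0" by (simp add: t_pr)
  then have "pr 0 0 + a = pr a d" by (metis add_0 c_pr gen_uminus(1) minus_unique pr_zero)
  then show False using a_neq_pr by metis
qed

definition KK :: "taut set" where
  "KK = gen {cj g t | g. g \<in> GG}"

lemma subgp_KK: "subgp KK"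
  by (simp add: KK_def subgp_gen)

lemma t_in_KK: "t \<in> KK"
  unfolding KK_def
  by (rule gen_base, rule CollectI, rule exI[of _ 0]) (simp add: subgpD[OF subgp_GG])

lemma normalized_KK: "normalized_by KK GG"
  unfolding KK_def
proof (rule normalized_gen)
  fix x g assume "x \<in> {cj g t |g. g \<in> GG}" "g \<in> GG"
  then obtain h where "cj g x = cj (h + g) t" "h + g \<in> GG"
    using subgpD(2)[OF subgp_GG] by auto
  then show "cj g x \<in> gen {cj g t |g. g \<in> GG}" by (intro gen_base) blast
qed

lemma KK_least: "subgp N \<Longrightarrow> normalized_by N GG \<Longrightarrow> t \<in> N \<Longrightarrow> KK \<subseteq> N"
  unfolding KK_def by (rule gen_least) (auto dest: normalized_byD)

lemma KK_subset_GG: "KK \<subseteq> GG"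
proof (rule KK_least[OF subgp_GG])
  show "normalized_by GG GG" by (rule normalized_byI) (rule cj_in[OF subgp_GG])
  show "t \<in> GG" unfolding t_def by (intro subgpD(2)[OF subgp_GG] gens_in_GG)
qed

abbreviation KL :: "nat \<Rightarrow> taut set" where
  "KL n \<equiv> lvl n KK"

lemma subgp_KL: "subgp (KL n)" and normalized_KL: "normalized_by (KL n) GG"
  by (simp_all add: subgp_lvl subgp_KK normalized_lvl normalized_KK)

lemma cj_c_t: "cj c t = - (pr 0 (cj c t)) + - t"
proof -
  have "cj c t = cj d (cj b t)" by (simp del: cj_simps add: cj_simps(5)[symmetric])
  then show ?thesis by (simp add: cj_t del: pr_uminus)
qed

lemma pr_0_t: "pr 0 (cj c t) \<in> KK" "pr 0 t \<in> KK" "pr t 0 \<in> KK"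
proof -
  have "cj d t \<in> KK" using normalized_byD[OF normalized_KK t_in_KK] by simp
  then have "- t + cj d t \<in> KK" using subgpD[OF subgp_KK] t_in_KK by blast
  then show *: "pr 0 (cj c t) \<in> KK" by (simp add: cj_t)
  have "cj b (pr 0 (cj c t)) \<in> KK" using normalized_byD[OF normalized_KK *] by simp
  moreover have "cj b (pr 0 (cj c t)) = pr 0 t"
    by (subst b_pr) (simp del: cj_simps(5) add: cj_simps(5)[symmetric])
  ultimately show "pr 0 t \<in> KK" by simp
  then show "pr t 0 \<in> KK" using normalized_byD[OF normalized_KK _ gens_in_GG(1)] cj_a_pr by metis
qed

lemma KL_1_subset: "KL (Suc 0) \<subseteq> KK"
proof (rule lvl_Suc_subset_of_left[OF subgp_KK normalized_KK])
  show "KL 0 \<subseteq> {x. pr x 0 \<in> KK}"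
    using KK_least[OF left_section_subgroup[OF subgp_KK normalized_KK]] pr_0_t by simp
qed

lemma KL_Suc_subset: "KL (Suc n) \<subseteq> KL n"
proof -
  have "KL (n + Suc 0) \<subseteq> KL n" unfolding lvl_add by (rule lvl_mono[OF KL_1_subset])
  then show ?thesis by simp
qed

lemma KL_antimono: "m \<le> n \<Longrightarrow> KL n \<subseteq> KL m"
  by (induction rule: dec_induct) (use KL_Suc_subset in blast)+

lemma KL_subset_GG: "KL n \<subseteq> GG"
  using KL_antimono[of 0 n] KK_subset_GG by auto

text \<open>The relations \<open>cj_t\<close> show that \<open>t\<close> and \<open>K \<times> K\<close> generate a subgroup normalized by \<open>a\<close>, \<open>b\<close>, \<open>d\<close>. So
statements about \<open>K\<close> that define a subgroup need checking only on \<open>t\<close> and on \<open>K \<times> K\<close>.\<close>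

lemma KK_least_of_t_KL1:
  assumes "subgp H" "t \<in> H" "KL (Suc 0) \<subseteq> H"
  shows "KK \<subseteq> H"
proof -
  let ?H = "gen ({t} \<union> KL (Suc 0))"
  note H = subgp_gen[of "{t} \<union> KL (Suc 0)"]
  have tH: "t \<in> ?H" and KH: "\<And>x. x \<in> KL (Suc 0) \<Longrightarrow> x \<in> ?H" by (auto intro: gen_base)
  have ct: "cj c t \<in> KK" using normalized_byD[OF normalized_KK t_in_KK] by simp
  have p: "pr 0 (cj c t) \<in> ?H" using subgpD(1)[OF subgp_KK] ct by (intro KH) simp
  have *: "cj g x \<in> ?H" if x: "x \<in> ?H" and g: "g \<in> {a, b, d}" for x g
    using x
  proof (induction)
    case (gen_base x)
    consider "x = t" | "x \<in> KL (Suc 0)" using gen_base by blast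
    then show ?case
    proof cases
      case 1
      then show ?thesis using g subgpD[OF H] tH p by (auto simp: cj_t)
    next
      case 2
      moreover have "g \<in> GG" using g by auto
      ultimately show ?thesis by (intro KH normalized_byD[OF normalized_KL])
    qed
  qed (auto intro: gen.intros)
  have "normalized_by ?H GG" by (rule normalized_by_GG) (use * in auto)
  then have "KK \<subseteq> ?H" using KK_least[OF H] tH by blast
  also have "?H \<subseteq> H" by (rule gen_least) (use assms in auto)
  finally show ?thesis .
qed

definition centralizer_mod :: "taut set \<Rightarrow> taut set \<Rightarrow> taut set" where
  "centralizer_mod N Y = {x \<in> GG. \<forall>y\<in>Y. comm x y \<in> N}"

lemma subgp_centralizer_mod:
  assumes N: "subgp N" "normalized_by N GG"
  shows "subgp (centralizer_mod N Y)"
proof (rule subgpI)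
  show "0 \<in> centralizer_mod N Y" using subgpD[OF N(1)] subgpD[OF subgp_GG] by (simp add: centralizer_mod_def)
next
  fix x z assume "x \<in> centralizer_mod N Y" "z \<in> centralizer_mod N Y"
  then show "x + z \<in> centralizer_mod N Y"
    using subgpD[OF N(1)] subgpD[OF subgp_GG] normalized_byD[OF N(2)] 
    by (simp add: centralizer_mod_def comm_plus_left)
next
  fix x assume "x \<in> centralizer_mod N Y"
  then show "- x \<in> centralizer_mod N Y"
    using subgpD[OF N(1)] subgpD[OF subgp_GG] normalized_byD[OF N(2)]
    by (simp add: centralizer_mod_def comm_uminus_left)
qed

lemma subset_centralizer_mod_commute:
  assumes "subgp N" "X \<subseteq> GG" "Y \<subseteq> GG" "X \<subseteq> centralizer_mod N Y"
  shows "Y \<subseteq> centralizer_mod N X"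
proof
  fix y assume y: "y \<in> Y"
  have "comm y x \<in> N" if x: "x \<in> X" for x
  proof -
    have "- comm x y \<in> N"
      by (rule subgpD(3)[OF assms(1)]) (use x y assms(4) in \<open>auto simp: centralizer_mod_def\<close>)
    then show ?thesis by (simp only: uminus_comm)
  qed
  then show "y \<in> centralizer_mod N X" using y assms(3) by (auto simp: centralizer_mod_def)
qed

text \<open>\<open>K\<close> is generated by \<open>t\<close> modulo \<open>K \<times> K\<close>.\<close>

lemma KK_abelian_mod_KL_1: "x \<in> KK \<Longrightarrow> y \<in> KK \<Longrightarrow> comm x y \<in> KL (Suc 0)"
proof -
  let ?N = "KL (Suc 0)"
  note N = subgp_KL[of "Suc 0"] normalized_KL[of "Suc 0"]
  have K1: "?N \<subseteq> centralizer_mod ?N Y" if "Y \<subseteq> GG" for Y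
    using comm_in_normalized[OF N] that KL_subset_GG unfolding centralizer_mod_def by blast
  have tG: "t \<in> GG" using t_in_KK KK_subset_GG by blast
  have "KK \<subseteq> centralizer_mod ?N {t}"
    by (rule KK_least_of_t_KL1[OF subgp_centralizer_mod[OF N]])
      (use K1[of "{t}"] tG subgpD(1)[OF N(1)] in \<open>auto simp: centralizer_mod_def\<close>)
  then have "t \<in> centralizer_mod ?N KK"
    using subset_centralizer_mod_commute[OF N(1) KK_subset_GG, of "{t}"] tG by blast
  then have "KK \<subseteq> centralizer_mod ?N KK"
    using KK_least_of_t_KL1[OF subgp_centralizer_mod[OF N]] K1[OF KK_subset_GG] by blast
  then show "x \<in> KK \<Longrightarrow> y \<in> KK \<Longrightarrow> comm x y \<in> ?N"
    unfolding centralizer_mod_def by blast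
qed

lemma comm_t_ca: "comm t (c + a) = cj t (- pr (cj c t) 0)"
proof -
  have "comm t (c + a) = - t + cj a (- (pr 0 (cj c t)) + - t)"
    by (simp add: comm_cj cj_c_t[symmetric] del: pr_uminus)
  then show ?thesis
    by (simp add: cj_t minus_minus minus_zero) (simp add: cj_def minus_minus add.assoc)
qed

text \<open>\<open>ca\<close> and \<open>ac\<close> are the sections of \<open>t\<close>; that they centralize \<open>K/K\<^sub>1\<close> is what makes \<open>t\<close> commute with \<open>K\<^sub>1\<close>
modulo \<open>K\<^sub>2\<close> in the next lemma.\<close>

lemma ca_centralizes_KK_mod_KL_1:
  assumes "x \<in> KK"
  shows "comm x (c + a) \<in> KL (Suc 0)" "comm x (a + c) \<in> KL (Suc 0)"
proof -
  let ?N = "KL (Suc 0)"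
  note N = subgp_KL[of "Suc 0"] normalized_KL[of "Suc 0"]
  have tG: "t \<in> GG" using t_in_KK KK_subset_GG by blast
  have G: "c + a \<in> GG" "a + c \<in> GG" using subgpD[OF subgp_GG] by simp_all
  have K: "KK \<subseteq> centralizer_mod ?N {y}" if "y \<in> GG" "comm t y \<in> ?N" for y
  proof (rule KK_least_of_t_KL1[OF subgp_centralizer_mod[OF N]])
    show "t \<in> centralizer_mod ?N {y}" using that tG by (simp add: centralizer_mod_def)
    show "?N \<subseteq> centralizer_mod ?N {y}"
      using comm_in_normalized[OF N] that(1) KL_subset_GG unfolding centralizer_mod_def by blast
  qed
  have ct: "cj c t \<in> KK" using normalized_byD[OF normalized_KK t_in_KK] by simp
  note comm_t_ca
  moreover have "cj t (- pr (cj c t) 0) \<in> ?N"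
    using ct subgpD[OF subgp_KK] minus_zero
    by (intro normalized_byD[OF N(2) _ tG] subgpD(3)[OF N(1)]) simp
  ultimately have "comm t (c + a) \<in> ?N" by metis
  then have *: "comm y (c + a) \<in> ?N" if "y \<in> KK" for y using K[OF G(1)] that by (auto simp: centralizer_mod_def)
  then show "comm x (c + a) \<in> ?N" using assms .
  have "cj (a + c) x \<in> KK" using normalized_byD[OF normalized_KK assms G(2)] .
  then have "- comm (cj (a + c) x) (c + a) \<in> ?N" using * subgpD(3)[OF N(1)] by blast
  moreover have "- comm (cj (a + c) x) (c + a) = comm x (a + c)"
    by (simp add: comm_def cj_def add.assoc minus_minus)
  ultimately show "comm x (a + c) \<in> ?N" by simp
qed

lemma KK_abelian_mod_KL_2: assumes "x \<in> KK" "y \<in> KK" shows "comm x y \<in> KL 2"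
proof -
  let ?N = "KL 2"
  note N = subgp_KL[of 2] normalized_KL[of 2]
  have two: "KL 2 = KL (Suc (Suc 0))" by (simp add: numeral_2_eq_2)
  note N2 = N[unfolded two]
  have tG: "t \<in> GG" using t_in_KK KK_subset_GG by blast
  have K1t: "KL (Suc 0) \<subseteq> centralizer_mod ?N {t}"
  proof
    fix z assume z: "z \<in> KL (Suc 0)"
    then obtain x y where "z = pr x y" "x \<in> KK" "y \<in> KK" by auto
    then have "comm z t \<in> ?N" using ca_centralizes_KK_mod_KL_1 by (simp add: t_pr two)
    then show "z \<in> centralizer_mod ?N {t}" using z KL_subset_GG unfolding centralizer_mod_def by blast
  qed
  have K11: "KL (Suc 0) \<subseteq> centralizer_mod ?N (KL (Suc 0))"
    using KL_subset_GG[of "Suc 0"] KK_abelian_mod_KL_1 by (auto simp: centralizer_mod_def two)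
  have "KK \<subseteq> centralizer_mod ?N {t}"
    by (rule KK_least_of_t_KL1[OF subgp_centralizer_mod[OF N]])
      (use K1t tG subgpD(1)[OF N(1)] in \<open>auto simp: centralizer_mod_def\<close>)
  then have t: "t \<in> centralizer_mod ?N KK"
    using subset_centralizer_mod_commute[OF N(1) KK_subset_GG, of "{t}"] tG by blast
  have "t \<in> centralizer_mod ?N (KL (Suc 0))"
    using subset_centralizer_mod_commute[OF N(1) KL_subset_GG, of "{t}"] tG K1t by blast
  then have "KK \<subseteq> centralizer_mod ?N (KL (Suc 0))"
    using KK_least_of_t_KL1[OF subgp_centralizer_mod[OF N]] K11 by blast
  then have "KL (Suc 0) \<subseteq> centralizer_mod ?N KK"
    using subset_centralizer_mod_commute[OF N(1) KK_subset_GG KL_subset_GG] by blast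
  then have "KK \<subseteq> centralizer_mod ?N KK"
    using KK_least_of_t_KL1[OF subgp_centralizer_mod[OF N]] t by blast
  then show ?thesis
    using assms unfolding centralizer_mod_def by blast
qed


declare lvl.simps(2) [simp del]

lemma lvl_SucE: "z \<in> lvl (Suc n) X \<Longrightarrow> (\<And>x y. z = pr x y \<Longrightarrow> x \<in> lvl n X \<Longrightarrow> y \<in> lvl n X \<Longrightarrow> R) \<Longrightarrow> R"
  by (auto simp: lvl.simps)

section \<open>The order of the generator modulo the next layer\<close>

text \<open>The element \<open>ca\<close> has order 8, by the computation \<open>(ca)\<^sup>2 = (ad, da)\<close> and \<open>(ad)\<^sup>2 = (b, b)\<close>.\<close>

lemma word_identities:
  "a + d + a + d = pr b b" "d + a + d + a = pr b b"
  "c + a + c + a = pr (a + d) (d + a)" "a + c + a + c = pr (d + a) (a + d)"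
proof -
  have ad: "cj a d = pr b 0" by (rule cj_a_pr[of 0 b, folded d_pr])
  have ac: "cj a c = pr d a" by (rule cj_a_pr[of a d, folded c_pr])
  have "a + d + a + d = cj a d + d" "d + a + d + a = d + cj a d" by (simp_all add: cj_def add.assoc)
  then show "a + d + a + d = pr b b" "d + a + d + a = pr b b"
    unfolding ad by (simp_all add: d_pr[THEN arg_cong, of "\<lambda>x. pr b 0 + x"] d_pr[THEN arg_cong, of "\<lambda>x. x + pr b 0"])
  have "c + a + c + a = c + cj a c" "a + c + a + c = cj a c + c" by (simp_all add: cj_def add.assoc)
  then show "c + a + c + a = pr (a + d) (d + a)" "a + c + a + c = pr (d + a) (a + d)"
    unfolding ac by (simp_all add: c_pr[THEN arg_cong, of "\<lambda>x. pr d a + x"] c_pr[THEN arg_cong, of "\<lambda>x. x + pr d a"])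
qed

lemma ca_fourth: "(c + a + c + a) + (c + a + c + a) = diag 2 b" "(a + c + a + c) + (a + c + a + c) = diag 2 b"
  unfolding word_identities(3,4) numeral_2_eq_2
  using word_identities(1,2) by (simp_all add: add.assoc)

lemma t_fourth: "t + t + (t + t) = diag 3 b"
proof -
  have "t + t + (t + t) = pr ((c + a + c + a) + (c + a + c + a)) ((a + c + a + c) + (a + c + a + c))"
    by (simp add: t_pr add.assoc)
  then show ?thesis unfolding ca_fourth by (simp add: numeral_3_eq_3 numeral_2_eq_2)
qed

text \<open>Modulo \<open>K\<close> the generator \<open>a\<close> commutes with \<open>b\<close>, so that \<open>(ac)\<^sup>4 = (abd)\<^sup>4 = (ad)\<^sup>4 = 1\<close> there. Keeping
track of the conjugates of \<open>t\<close> used, \<open>(ac)\<^sup>2 = tw\<close> with the involution \<open>w = b(ad)\<^sup>2b\<close>.\<close>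

lemma diag_2_b_in_KK: "diag 2 b \<in> KK"
proof -
  define w where "w = cj b (a + d + a + d)"
  have "- (a + d + a + d) = a + d + a + d" unfolding word_identities(1) by simp
  then have w: "- w = w" unfolding w_def by (simp del: cj_simps minus_add add: cj_simps(4)[symmetric])
  have "w \<in> GG" unfolding w_def by (intro cj_in subgpD subgp_GG gens_in_GG)
  then have "cj w t \<in> KK" using normalized_byD[OF normalized_KK t_in_KK] by blast
  then have "t + cj w t \<in> KK" using subgpD(2)[OF subgp_KK t_in_KK] by blast
  moreover have "t + w = a + c + a + c"
    by (simp add: t_def w_def cj_def add.assoc)
  then have "diag 2 b = (t + w) + (t + w)" using ca_fourth(2) by simp
  then have "diag 2 b = t + cj w t" using w by (simp add: cj_def add.assoc)
  ultimately show ?thesis by simp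
qed

lemma t_fourth_in_KL_1: "t + t + (t + t) \<in> KL (Suc 0)"
proof -
  have "diag 3 b = pr (diag 2 b) (diag 2 b)" by (simp add: numeral_3_eq_3 numeral_2_eq_2)
  then show ?thesis using diag_2_b_in_KK t_fourth by simp
qed

primrec nmul :: "nat \<Rightarrow> 'a::group_add \<Rightarrow> 'a" where
  "nmul 0 x = 0"
| "nmul (Suc n) x = x + nmul n x"

lemma nmul_add: "nmul (m + n) x = nmul m x + nmul n x"
  by (induction m) (simp_all add: add.assoc)

lemma nmul_mult: "nmul (m * n) x = nmul m (nmul n x)"
  by (induction m) (simp_all add: nmul_add)

lemma nmul_in: "subgp H \<Longrightarrow> x \<in> H \<Longrightarrow> nmul n x \<in> H"
  by (induction n) (simp_all add: subgpD)

lemma cong_KL_plus: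
  assumes "y \<in> GG" "cong_mod (KL n) x x'" "cong_mod (KL n) y y'"
  shows "cong_mod (KL n) (x + y) (x' + y')"
  by (rule cong_plus[OF subgp_KL normalized_KL assms])

text \<open>Exponents are natural numbers, as only their
residues modulo 4 matter; negation is multiplication by 3.\<close>

definition t_exponent :: "taut \<Rightarrow> nat \<Rightarrow> bool" where
  "t_exponent x n \<longleftrightarrow> x \<in> KK \<and> cong_mod (KL (Suc 0)) (nmul n t) x"

lemma nmul_t_GG: "nmul n t \<in> GG"
  using nmul_in[OF subgp_KK t_in_KK] KK_subset_GG by blast

lemma t_exponent_KL_1: "x \<in> KL (Suc 0) \<Longrightarrow> t_exponent x 0"
  using KL_1_subset by (auto simp: t_exponent_def cong_mod_def minus_zero)

lemma t_exponent_t: "t_exponent t 1"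
  using t_in_KK cong_refl[OF subgp_KL] by (simp add: t_exponent_def)

lemma t_exponent_plus: "t_exponent x m \<Longrightarrow> t_exponent y n \<Longrightarrow> t_exponent (x + y) (m + n)"
  unfolding t_exponent_def nmul_add using subgpD(2)[OF subgp_KK] cong_KL_plus[OF nmul_t_GG] by blast

lemma nmul_4_t: "nmul (n * 4) t \<in> KL (Suc 0)"
  unfolding nmul_mult
  by (rule nmul_in[OF subgp_KL]) (use t_fourth_in_KL_1 in \<open>simp add: numeral_eq_Suc add.assoc\<close>)

lemma t_exponent_uminus: assumes "t_exponent x n" shows "t_exponent (- x) (3 * n)"
proof -
  have "nmul (4 * n) t \<in> KL (Suc 0)"
    using nmul_4_t by (simp add: mult.commute)
  then have "- nmul (3 * n + n) t \<in> KL (Suc 0)" using subgpD(3)[OF subgp_KL] by simp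
  moreover have "- nmul (n + 3 * n) t = - nmul (3 * n) t + - nmul n t"
    by (simp only: nmul_add minus_add)
  ultimately have "cong_mod (KL (Suc 0)) (nmul (3 * n) t) (- nmul n t)"
    by (simp add: cong_mod_def add.commute)
  moreover have "cong_mod (KL (Suc 0)) (- nmul n t) (- x)"
    using assms subgpD(3)[OF subgp_GG nmul_t_GG]
    unfolding t_exponent_def by (intro cong_uminus[OF subgp_KL normalized_KL]) auto
  ultimately show ?thesis
    using assms subgpD(3)[OF subgp_KK] cong_trans[OF subgp_KL] unfolding t_exponent_def by blast
qed

lemma t_exponent_dvd: assumes "t_exponent x n" "4 dvd n" shows "x \<in> KL (Suc 0)"
proof -
  obtain k where n: "n = k * 4" using assms(2) by (metis dvdE mult.commute)
  have "nmul n t \<in> KL (Suc 0)"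
    using nmul_4_t by (simp add: n)
  moreover have "cong_mod (KL (Suc 0)) (nmul n t) x" using assms(1) by (simp add: t_exponent_def)
  ultimately show ?thesis using cong_mem[OF subgp_KL subset_refl] cong_sym[OF subgp_KL] by blast
qed

lemma t_exponent_nmul: "t_exponent u e \<Longrightarrow> t_exponent (nmul n u) (n * e)"
  by (induction n) (simp_all add: t_exponent_KL_1 subgpD[OF subgp_KL] t_exponent_plus)

lemma t_exponent_cong:
  assumes "t_exponent u n" "cong_mod (KL (Suc 0)) u v" "v \<in> KK"
  shows "t_exponent v n"
  using assms cong_trans[OF subgp_KL] unfolding t_exponent_def by blast

lemma cj_nmul: "cj g (nmul n x) = nmul n (cj g x)"
  by (induction n) simp_all

lemma t_exponent_cj:
  assumes "g \<in> GG" "t_exponent (cj g t) e" "t_exponent x n"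
  shows "t_exponent (cj g x) (n * e)"
proof (rule t_exponent_cong[OF t_exponent_nmul[OF assms(2), of n]])
  show "cong_mod (KL (Suc 0)) (nmul n (cj g t)) (cj g x)"
    using cong_cj[OF normalized_KL assms(1)] assms(3) unfolding t_exponent_def cj_nmul[symmetric] by blast
  show "cj g x \<in> KK" using assms(1,3) normalized_byD[OF normalized_KK] by (simp add: t_exponent_def)
qed

lemma t_exponent_cj_d: "t_exponent x n \<Longrightarrow> t_exponent (cj d x) n"
proof -
  have "cj c t \<in> KK" using normalized_byD[OF normalized_KK t_in_KK] by simp
  then have "t_exponent (pr 0 (cj c t)) 0" using subgpD[OF subgp_KK] by (intro t_exponent_KL_1) simp
  then have "t_exponent (cj d t) (1 + 0)" unfolding cj_t by (rule t_exponent_plus[OF t_exponent_t])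
  then have "t_exponent (cj d t) 1" by simp
  then show "t_exponent x n \<Longrightarrow> t_exponent (cj d x) n" using t_exponent_cj[of d 1] by simp
qed

lemma t_exponent_cj_a: "t_exponent x n \<Longrightarrow> t_exponent (cj a x) (n * 3)"
  using t_exponent_cj[of a 3] t_exponent_uminus[OF t_exponent_t] by (simp add: cj_t)

lemma t_exponent_exists: "x \<in> KK \<Longrightarrow> \<exists>n. t_exponent x n"
proof -
  have "KK \<subseteq> {x. \<exists>n. t_exponent x n}"
  proof (rule KK_least_of_t_KL1)
    show "subgp {x. \<exists>n. t_exponent x n}"
      by (rule subgpI) (auto intro: t_exponent_plus t_exponent_uminus t_exponent_KL_1 subgpD[OF subgp_KL])
  qed (use t_exponent_t t_exponent_KL_1 in blast)+
  then show "x \<in> KK \<Longrightarrow> \<exists>n. t_exponent x n" by blast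
qed

section \<open>Commuting with a fixed element\<close>

text \<open>Modulo \<open>P\<close> the subgroup \<open>H\<close> is abelian, and so commuting with a fixed \<open>s\<close> is an endomorphism of
\<open>H/P\<close> that depends only on the coset of \<open>s\<close> modulo \<open>H\<close>.\<close>

locale abelian_section =
  fixes H P :: "taut set"
  assumes H: "subgp H" "normalized_by H GG" "H \<subseteq> GG"
    and P: "subgp P" "normalized_by P GG"
    and comm_HH: "\<And>x y. x \<in> H \<Longrightarrow> y \<in> H \<Longrightarrow> comm x y \<in> P"
begin

lemma comm_in_H: "x \<in> H \<Longrightarrow> s \<in> GG \<Longrightarrow> comm x s \<in> H"
  by (rule comm_in_normalized[OF H(1,2)])

lemma comm_cong:
  assumes "x \<in> GG" "s \<in> GG" "cong_mod P x y"
  shows "cong_mod P (comm x s) (comm y s)"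
proof -
  let ?u = "comm x s" and ?e = "- x + y"
  have u: "?u \<in> GG" using assms by (intro comm_in subgp_GG)
  have e: "?e \<in> P" using assms by (simp add: cong_mod_def)
  have "comm ?e ?u \<in> P" "comm ?e s \<in> P"
    by (rule comm_in_normalized[OF P e u] comm_in_normalized[OF P e assms(2)])+
  then have "- comm ?e ?u + comm ?e s \<in> P"
    by (rule subgpD(2)[OF P(1) subgpD(3)[OF P(1)]])
  moreover have "- comm ?e ?u + comm ?e s = - ?u + comm y s"
    by (simp add: comm_def add.assoc minus_minus)
  ultimately show ?thesis by (simp add: cong_mod_def)
qed

lemma comm_hom:
  assumes "x \<in> H" "y \<in> H" "s \<in> GG"
  shows "cong_mod P (comm x s + comm y s) (comm (x + y) s)"
proof -
  let ?u = "comm x s" and ?v = "comm y s"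
  have u: "?u \<in> H" "?v \<in> H" using assms comm_in_H by auto
  then have "cj ?v (comm ?u y) \<in> P"
    using normalized_byD[OF P(2) comm_HH[OF u(1) assms(2)]] H(3) by blast
  moreover have "cj ?v (comm ?u y) = - (?u + ?v) + comm (x + y) s"
    by (simp add: comm_def cj_def add.assoc minus_minus)
  ultimately show ?thesis unfolding cong_mod_def by simp
qed

lemma comm_change:
  assumes "x \<in> H" "k \<in> H" "s \<in> GG"
  shows "cong_mod P (comm x s) (comm x (s + k))"
proof -
  let ?u = "comm x s"
  have u: "?u \<in> H" using assms comm_in_H by auto
  then have "cj ?u (comm x k) + comm ?u k \<in> P"
    using assms comm_HH H(3) by (intro subgpD(2)[OF P(1)] normalized_byD[OF P(2)]) auto
  moreover have "cj ?u (comm x k) + comm ?u k = - ?u + comm x (s + k)"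
    by (simp add: comm_def cj_def add.assoc minus_minus)
  ultimately show ?thesis by (simp add: cong_mod_def)
qed

abbreviation iter :: "taut \<Rightarrow> nat \<Rightarrow> taut \<Rightarrow> taut" where
  "iter s i \<equiv> (\<lambda>x. comm x s) ^^ i"

lemma iter_in_H: "x \<in> H \<Longrightarrow> s \<in> GG \<Longrightarrow> iter s i x \<in> H"
  by (induction i) (simp_all add: comm_in_H)

lemma iter_cong:
  assumes "x \<in> H" "y \<in> H" "s \<in> GG" "cong_mod P x y"
  shows "cong_mod P (iter s i x) (iter s i y)"
proof (induction i)
  case (Suc i)
  have "iter s i x \<in> GG" using iter_in_H assms H(3) by blast
  then show ?case using comm_cong Suc assms(3) by simp
qed (use assms in simp)

lemma iter_change:
  assumes "x \<in> H" "k \<in> H" "s \<in> GG"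
  shows "cong_mod P (iter s i x) (iter (s + k) i x)"
proof (induction i)
  case 0
  then show ?case using cong_refl[OF P(1)] by simp
next
  case (Suc i)
  have sk: "s + k \<in> GG" using subgpD(2)[OF subgp_GG assms(3)] assms(2) H(3) by blast
  have "cong_mod P (comm (iter s i x) s) (comm (iter s i x) (s + k))"
    using iter_in_H assms by (intro comm_change) auto
  moreover have "cong_mod P (comm (iter s i x) (s + k)) (comm (iter (s + k) i x) (s + k))"
    using iter_in_H[OF assms(1,3)] H(3) sk Suc by (intro comm_cong) auto
  ultimately show ?case using cong_trans[OF P(1)] by simp
qed

lemma iter_hom:
  assumes "x \<in> H" "y \<in> H" "s \<in> GG"
  shows "cong_mod P (iter s i x + iter s i y) (iter s i (x + y))"
proof (induction i)
  case 0
  then show ?case using cong_refl[OF P(1)] by simp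
next
  case (Suc i)
  have mem: "iter s i x \<in> H" "iter s i y \<in> H" using iter_in_H assms by auto
  have "cong_mod P (comm (iter s i x) s + comm (iter s i y) s) (comm (iter s i x + iter s i y) s)"
    using comm_hom mem assms(3) by blast
  moreover have "cong_mod P (comm (iter s i x + iter s i y) s) (comm (iter s i (x + y)) s)"
    using subgpD(2)[OF H(1) mem] H(3) assms(3) Suc by (intro comm_cong) auto
  ultimately show ?case using cong_trans[OF P(1)] by simp
qed

end

lemma KK_section: "abelian_section KK (KL 2)"
  using subgp_KK normalized_KK KK_subset_GG subgp_KL normalized_KL KK_abelian_mod_KL_2
  by unfold_locales auto

lemma KL_section: "abelian_section (KL n) (KL (n + 2))"
proof
  show "comm x y \<in> KL (n + 2)" if "x \<in> KL n" "y \<in> KL n" for x y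
    unfolding lvl_add[of n 2] using lvl_comm[OF KK_abelian_mod_KL_2] that by blast
qed (rule KL_subset_GG subgp_KL normalized_KL)+

text \<open>The two properties of \<open>f \<mapsto> [f,s]\<close> that drive the approximation: it maps \<open>K\<close> onto \<open>K\<^sub>1\<close>
modulo \<open>K\<^sub>2\<close>, and its fourth power kills \<open>K\<^sub>1\<close> modulo \<open>K\<^sub>2\<close>.\<close>

definition onto :: "taut \<Rightarrow> bool" where
  "onto s \<longleftrightarrow> (\<forall>z\<in>KL 1. \<exists>f\<in>KK. cong_mod (KL 2) (comm f s) z)"

definition nil4 :: "taut \<Rightarrow> bool" where
  "nil4 s \<longleftrightarrow> (\<forall>z\<in>KL 1. ((\<lambda>x. comm x s) ^^ 4) z \<in> KL 2)"

lemma comm_pr_ca: "comm (pr x y) (c + a) = pr (- x + cj d y) (- y + cj a x)"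
proof -
  have "comm (pr x y) (c + a) = - pr x y + cj a (cj (pr a d) (pr x y))"
    by (simp only: comm_cj cj_simps(5) c_pr[symmetric])
  then show ?thesis by simp
qed

text \<open>In exponents of \<open>t\<close>, commuting with \<open>ca\<close> is \<open>(m, n) \<mapsto> (n - m, - n - m)\<close> modulo 4. Its square is
\<open>(m, n) \<mapsto> (- 2 n, 2 m)\<close>, and its fourth power is multiplication by \<open>- 4\<close>.\<close>

lemma nil4_ca: "nil4 (c + a)"
  unfolding nil4_def
proof
  fix z assume "z \<in> KL 1"
  then obtain x0 y0 where z: "z = pr x0 y0" "x0 \<in> KK" "y0 \<in> KK" by (auto elim: lvl_SucE)
  obtain m n where mn: "t_exponent x0 m" "t_exponent y0 n" using z t_exponent_exists by blast
  define R where "R z m n \<longleftrightarrow> (\<exists>x y. z = pr x y \<and> t_exponent x m \<and> t_exponent y n)" for z m n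
  have step: "R (comm z (c + a)) (3 * m + n) (3 * n + m * 3)" if R: "R z m n" for z m n
  proof -
    obtain x y where xy: "z = pr x y" "t_exponent x m" "t_exponent y n" using R unfolding R_def by blast
    show ?thesis unfolding R_def xy(1) comm_pr_ca
      using t_exponent_plus[OF t_exponent_uminus[OF xy(2)] t_exponent_cj_d[OF xy(3)]]
        t_exponent_plus[OF t_exponent_uminus[OF xy(3)] t_exponent_cj_a[OF xy(2)]] by blast
  qed
  define m1 n1 where "m1 = 3 * m + n" and "n1 = 3 * n + m * 3"
  define m2 n2 where "m2 = 3 * m1 + n1" and "n2 = 3 * n1 + m1 * 3"
  define m3 n3 where "m3 = 3 * m2 + n2" and "n3 = 3 * n2 + m2 * 3"
  define m4 n4 where "m4 = 3 * m3 + n3" and "n4 = 3 * n3 + m3 * 3"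
  note defs = m1_def n1_def m2_def n2_def m3_def n3_def m4_def n4_def
  have "R z m n" using mn z unfolding R_def by blast
  from this[THEN step, THEN step, THEN step, THEN step]
  have "R (((\<lambda>x. comm x (c + a)) ^^ 4) z) m4 n4"
    unfolding defs by (simp add: eval_nat_numeral(2,3))
  moreover have "4 dvd m4" "4 dvd n4" unfolding defs by presburger+
  ultimately show "((\<lambda>x. comm x (c + a)) ^^ 4) z \<in> KL 2"
    unfolding R_def using t_exponent_dvd by (auto simp: numeral_2_eq_2)
qed

lemma cong_pr: "cong_mod (lvl (Suc n) X) (pr x y) (pr x' y') \<longleftrightarrow>
    cong_mod (lvl n X) x x' \<and> cong_mod (lvl n X) y y'"
  by (simp add: cong_mod_def)

text \<open>The image is a subgroup modulo \<open>K\<^sub>2\<close>. It contains \<open>[t, ca]\<close>, which is \<open>(t, 1)\<close> up to \<open>K\<^sub>2\<close>, hence the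
whole left factor of \<open>K \<times> K\<close>; and it contains \<open>[(1, y), ca] = (y\<^sup>d, y\<^sup>-\<^sup>1)\<close>, which then gives the right
factor.\<close>

lemma onto_ca: "onto (c + a)"
proof -
  interpret abelian_section KK "KL 2" by (rule KK_section)
  let ?s = "c + a"
  have s: "?s \<in> GG" by (intro subgpD subgp_GG gens_in_GG)
  define I where "I = {z. \<exists>f\<in>KK. cong_mod (KL 2) (comm f ?s) z}"
  have I_subgp: "subgp I"
  proof (rule subgpI)
    show "0 \<in> I" unfolding I_def using subgpD(1)[OF subgp_KK] cong_refl[OF P(1)] comm_zero(1) by force
  next
    fix x y assume "x \<in> I" "y \<in> I"
    then obtain f g where fg: "f \<in> KK" "g \<in> KK" "cong_mod (KL 2) (comm f ?s) x" "cong_mod (KL 2) (comm g ?s) y"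
      unfolding I_def by blast
    have "cong_mod (KL 2) (comm f ?s + comm g ?s) (x + y)"
      using comm_in[OF subgp_GG _ s] fg KK_subset_GG by (intro cong_KL_plus) auto
    then have "cong_mod (KL 2) (comm (f + g) ?s) (x + y)"
      using cong_trans[OF P(1) cong_sym[OF P(1) comm_hom[OF fg(1,2) s]]] by blast
    then show "x + y \<in> I" unfolding I_def using fg subgpD(2)[OF subgp_KK] by blast
  next
    fix x assume "x \<in> I"
    then obtain f where f: "f \<in> KK" "cong_mod (KL 2) (comm f ?s) x" unfolding I_def by blast
    have mf: "- f \<in> KK" using f subgpD(3)[OF subgp_KK] by blast
    have u: "comm f ?s \<in> GG" "comm (- f) ?s \<in> GG"
      using comm_in[OF subgp_GG _ s] f mf KK_subset_GG by auto
    have "cong_mod (KL 2) (comm f ?s + comm (- f) ?s) 0"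
      using comm_hom[OF f(1) mf s] by simp
    then have "cong_mod (KL 2) (- comm f ?s + (comm f ?s + comm (- f) ?s)) (- x + 0)"
      using f u subgpD[OF subgp_GG] by (intro cong_KL_plus cong_uminus[OF P]) auto
    then have "cong_mod (KL 2) (comm (- f) ?s) (- x)" by simp
    then show "- x \<in> I" unfolding I_def using mf by blast
  qed
  have I_base: "comm f ?s \<in> I" if "f \<in> KK" for f
    unfolding I_def using that cong_refl[OF P(1)] by blast
  have I_2: "KL 2 \<subseteq> I"
    unfolding I_def using subgpD(1)[OF subgp_KK] by (force simp: cong_mod_def minus_zero)
  \<comment> \<open>the left factor, from \<open>[t, ca]\<close>\<close>
  have left: "pr x 0 \<in> I" if "x \<in> KK" for x
  proof -
    let ?J = "{x. pr x 0 \<in> I}"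
    have J: "subgp ?J"
    proof (rule subgpI; clarsimp)
      show "0 \<in> I" using I_subgp by (rule subgpD)
      show "pr (x + y) 0 \<in> I" if "pr x 0 \<in> I" "pr y 0 \<in> I" for x y
        using subgpD(2)[OF I_subgp that] by simp
      show "pr (- x) 0 \<in> I" if "pr x 0 \<in> I" for x
        using subgpD(3)[OF I_subgp that] by (simp add: minus_zero)
    qed
    have K1: "KL (Suc 0) \<subseteq> ?J"
      using I_2 subgpD(1)[OF subgp_KL, of "Suc 0"] by (auto simp: numeral_2_eq_2)
    have ct: "cj c t \<in> KK" using normalized_byD[OF normalized_KK t_in_KK] by simp
    note comm_t_ca
    also have "cj t (- pr (cj c t) 0) = - pr (cj c t) 0 + comm (- pr (cj c t) 0) t"
      by (simp add: comm_cj del: pr_uminus)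
    finally have "comm t ?s = - pr (cj c t) 0 + comm (- pr (cj c t) 0) t" .
    moreover have "comm (- pr (cj c t) 0) t \<in> I"
    proof -
      have "- pr (cj c t) 0 \<in> KL (Suc 0)" using ct subgpD[OF subgp_KK] by (simp add: minus_zero)
      then have "- pr (cj c t) 0 \<in> KK" using KL_1_subset by blast
      then show ?thesis using comm_HH t_in_KK I_2 by blast
    qed
    ultimately have "comm t ?s + - comm (- pr (cj c t) 0) t \<in> I"
        "comm t ?s + - comm (- pr (cj c t) 0) t = - pr (cj c t) 0"
      using subgpD(2)[OF I_subgp I_base[OF t_in_KK] subgpD(3)[OF I_subgp]]
      by (blast, simp add: add.assoc del: pr_uminus)
    then have "- pr (cj c t) 0 \<in> I" by simp
    then have "pr (cj c t) 0 \<in> I" using subgpD(3)[OF I_subgp] minus_minus by metis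
    then have cJ: "cj c t \<in> ?J" by simp
    have "pr 0 (cj c t) \<in> KL (Suc 0)" using ct subgpD(1)[OF subgp_KK] by simp
    then have "pr 0 (cj c t) \<in> ?J" using K1 by blast
    then have "- (pr 0 (cj c t) + cj c t) \<in> ?J" using subgpD(2,3)[OF J] cJ by blast
    moreover have "- (pr 0 (cj c t) + cj c t) = t"
      by (subst (2) cj_c_t) (simp add: minus_minus del: pr_uminus)
    ultimately have "t \<in> ?J" by simp
    then show ?thesis using KK_least_of_t_KL1[OF J _ K1] that by blast
  qed
  \<comment> \<open>the right factor, from \<open>[(1, y), ca]\<close> and the left factor\<close>
  have right: "pr 0 y \<in> I" if "y \<in> KK" for y
  proof -
    have "pr 0 y \<in> KK" using KL_1_subset that subgpD(1)[OF subgp_KK] by auto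
    then have "pr (cj d y) (- y) \<in> I"
      using I_base[of "pr 0 y"] by (simp only: comm_pr_ca) (simp add: minus_zero)
    moreover have "pr (cj d y) 0 \<in> I"
      by (rule left) (use that normalized_byD[OF normalized_KK] in auto)
    ultimately have "- pr (cj d y) (- y) + pr (cj d y) 0 \<in> I" using subgpD[OF I_subgp] by blast
    then show ?thesis by (simp add: minus_minus)
  qed
  show ?thesis unfolding onto_def
  proof
    fix z assume "z \<in> KL 1"
    then obtain x y where "z = pr x 0 + pr 0 y" "x \<in> KK" "y \<in> KK" by (auto elim: lvl_SucE)
    then have "z \<in> I" using left right subgpD(2)[OF I_subgp] by blast
    then show "\<exists>f\<in>KK. cong_mod (KL 2) (comm f ?s) z" unfolding I_def by blast
  qed
qed

text \<open>Since \<open>K\<close> is abelian modulo \<open>K\<^sub>2\<close>, a factor from \<open>K\<close> does not change the map; conjugation by \<open>a\<close>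
takes \<open>ca\<close> to \<open>ac\<close>, the other section of \<open>t\<close>.\<close>

lemma onto_nil4_change:
  assumes "s \<in> GG" "k \<in> KK" "onto s" "nil4 s"
  shows "onto (s + k)" "nil4 (s + k)"
proof -
  interpret abelian_section KK "KL 2" by (rule KK_section)
  show "onto (s + k)"
    unfolding onto_def
    using assms cong_trans[OF P(1) cong_sym[OF P(1) comm_change[OF _ assms(2,1)]]]
    unfolding onto_def by blast
  show "nil4 (s + k)"
    unfolding nil4_def
  proof
    fix z assume z: "z \<in> KL 1"
    then have "z \<in> KK" using KL_1_subset by auto
    then have "cong_mod (KL 2) (iter (s + k) 4 z) (iter s 4 z)"
      using cong_sym[OF P(1)] iter_change assms by blast
    moreover have "iter s 4 z \<in> KL 2" using assms(4) z by (simp add: nil4_def)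
    ultimately show "iter (s + k) 4 z \<in> KL 2" using cong_mem[OF P(1) subset_refl] by blast
  qed
qed

lemma onto_nil4_swap:
  assumes "onto s" "nil4 s"
  shows "onto (cj a s)" "nil4 (cj a s)"
proof -
  have aa: "cj a (cj a x) = x" for x by (simp add: cj_def add.assoc)
  have inL: "cj a x \<in> KL n" if "x \<in> KL n" for x n using normalized_byD[OF normalized_KL that] by simp
  have cc: "cj a (comm x s) = comm (cj a x) (cj a s)" for x by (rule cj_comm)
  show "onto (cj a s)"
    unfolding onto_def
  proof
    fix z assume "z \<in> KL 1"
    then obtain f where f: "f \<in> KK" "cong_mod (KL 2) (comm f s) (cj a z)"
      using assms(1) inL unfolding onto_def by blast
    then have "cong_mod (KL 2) (cj a (comm f s)) (cj a (cj a z))"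
      by (intro cong_cj[OF normalized_KL gens_in_GG(1)])
    moreover have "cj a f \<in> KK" using inL[of f 0] f(1) by simp
    ultimately show "\<exists>f\<in>KK. cong_mod (KL 2) (comm f (cj a s)) z"
      unfolding cc aa by blast
  qed
  have it: "((\<lambda>x. comm x (cj a s)) ^^ i) (cj a z) = cj a (((\<lambda>x. comm x s) ^^ i) z)" for i z
    by (induction i) (simp_all add: cc)
  show "nil4 (cj a s)"
    unfolding nil4_def
  proof
    fix z assume "z \<in> KL 1"
    then have "((\<lambda>x. comm x s) ^^ 4) (cj a z) \<in> KL 2" using assms(2) inL unfolding nil4_def by blast
    then show "((\<lambda>x. comm x (cj a s)) ^^ 4) z \<in> KL 2"
      using it[of 4 "cj a z"] inL unfolding aa by simp
  qed
qed

text \<open>Only the coset of \<open>t\<close> is prescribed here, so an approximation of \<open>t\<close> is as good as \<open>t\<close> itself.\<close>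

lemma t_coset_onto_nil4:
  assumes "e \<in> KL (Suc 0)"
  shows "t + e \<in> lvl (Suc 0) {s. onto s \<and> nil4 s}"
proof -
  obtain x y where e: "e = pr x y" "x \<in> KK" "y \<in> KK" using assms by (auto elim: lvl_SucE)
  have ca: "c + a \<in> GG" "a + c \<in> GG" by (intro subgpD subgp_GG gens_in_GG)+
  have "cj a (c + a) = a + c" by (simp add: cj_def add.assoc)
  then have "onto (a + c)" "nil4 (a + c)" using onto_nil4_swap[OF onto_ca nil4_ca] by simp_all
  then show ?thesis
    using onto_nil4_change ca e onto_ca nil4_ca by (simp add: t_pr)
qed

lemma onto_lvl:
  "s \<in> lvl n {s. onto s \<and> nil4 s} \<Longrightarrow> z \<in> KL (n + 1) \<Longrightarrow> \<exists>f\<in>KL n. cong_mod (KL (n + 2)) (comm f s) z"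
proof (induction n arbitrary: s z)
  case 0
  then show ?case by (simp add: onto_def numeral_2_eq_2)
next
  case (Suc n)
  obtain s0 s1 where s: "s = pr s0 s1" "s0 \<in> lvl n {s. onto s \<and> nil4 s}" "s1 \<in> lvl n {s. onto s \<and> nil4 s}"
    using Suc.prems(1) by (auto elim: lvl_SucE)
  obtain z0 z1 where z: "z = pr z0 z1" "z0 \<in> KL (n + 1)" "z1 \<in> KL (n + 1)"
    using Suc.prems(2) by (auto elim: lvl_SucE)
  obtain f0 f1 where "f0 \<in> KL n" "f1 \<in> KL n" "cong_mod (KL (n + 2)) (comm f0 s0) z0"
    "cong_mod (KL (n + 2)) (comm f1 s1) z1" using Suc.IH s z by blast
  then show ?case by (intro bexI[of _ "pr f0 f1"]) (simp_all add: s z cong_pr)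
qed

lemma nil4_lvl:
  "s \<in> lvl n {s. onto s \<and> nil4 s} \<Longrightarrow> z \<in> KL (n + 1) \<Longrightarrow> ((\<lambda>x. comm x s) ^^ 4) z \<in> KL (n + 2)"
proof (induction n arbitrary: s z)
  case 0
  then show ?case by (simp add: nil4_def numeral_2_eq_2)
next
  case (Suc n)
  obtain s0 s1 where s: "s = pr s0 s1" "s0 \<in> lvl n {s. onto s \<and> nil4 s}" "s1 \<in> lvl n {s. onto s \<and> nil4 s}"
    using Suc.prems(1) by (auto elim: lvl_SucE)
  obtain z0 z1 where z: "z = pr z0 z1" "z0 \<in> KL (n + 1)" "z1 \<in> KL (n + 1)"
    using Suc.prems(2) by (auto elim: lvl_SucE)
  have "((\<lambda>x. comm x s) ^^ i) z = pr (((\<lambda>x. comm x s0) ^^ i) z0) (((\<lambda>x. comm x s1) ^^ i) z1)" for i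
    by (induction i) (simp_all add: s z)
  then show ?case using Suc.IH s z by simp
qed


section \<open>Approximation by short words\<close>

definition ball :: "taut set \<Rightarrow> nat \<Rightarrow> taut set" where
  "ball S n = {sum_list ws | ws. set ws \<subseteq> S \<union> uminus ` S \<and> length ws \<le> n}"

lemma ball_zero: "0 \<in> ball S n"
  unfolding ball_def by (rule CollectI, rule exI[of _ "[]"]) simp

lemma ball_mono: "m \<le> n \<Longrightarrow> ball S m \<subseteq> ball S n"
  unfolding ball_def by fastforce

lemma ball_plus: "x \<in> ball S m \<Longrightarrow> y \<in> ball S n \<Longrightarrow> x + y \<in> ball S (m + n)"
proof -
  assume "x \<in> ball S m" "y \<in> ball S n"
  then obtain us vs where "x = sum_list us" "set us \<subseteq> S \<union> uminus ` S" "length us \<le> m"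
    "y = sum_list vs" "set vs \<subseteq> S \<union> uminus ` S" "length vs \<le> n"
    unfolding ball_def by auto
  then show ?thesis
    unfolding ball_def by (intro CollectI exI[of _ "us @ vs"]) auto
qed

lemma ball_uminus: "x \<in> ball S n \<Longrightarrow> - x \<in> ball S n"
proof -
  assume "x \<in> ball S n"
  then obtain ws where ws: "x = sum_list ws" "set ws \<subseteq> S \<union> uminus ` S" "length ws \<le> n"
    unfolding ball_def by auto
  have "- sum_list ws = sum_list (rev (map uminus ws))"
    by (induction ws) (simp_all add: minus_zero)
  moreover have "set (rev (map uminus ws)) \<subseteq> S \<union> uminus ` S"
    using ws(2) by (force simp: minus_minus)
  ultimately show ?thesis using ws unfolding ball_def
    by (intro CollectI exI[of _ "rev (map uminus ws)"]) auto
qed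

lemma ball_comm:
  assumes "x \<in> ball S m" "y \<in> ball S n"
  shows "comm x y \<in> ball S (2 * m + 2 * n)"
proof -
  have "- x + - y + x + y \<in> ball S (m + n + m + n)"
    by (intro ball_plus ball_uminus assms)
  moreover have "m + n + m + n = 2 * m + 2 * n" by simp
  ultimately show ?thesis by (simp only: comm_def)
qed

context abelian_section
begin

lemma ball_iter:
  assumes "x \<in> ball S l" "s \<in> ball S ls"
  shows "iter s i x \<in> ball S (2 ^ i * l + (2 ^ (i + 1) - 2) * ls)"
proof (induction i)
  case 0
  then show ?case using assms by simp
next
  case (Suc i)
  obtain p where "(2::nat) ^ i = Suc p" by (metis gr0_implies_Suc zero_less_numeral zero_less_power)
  then have "2 * (2 ^ i * l + (2 ^ (i + 1) - 2) * ls) + 2 * ls = 2 ^ Suc i * l + (2 ^ (Suc i + 1) - 2) * ls"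
    by (simp add: algebra_simps)
  moreover have "iter s (Suc i) x = comm (iter s i x) s" by simp
  ultimately show ?case using ball_comm[OF Suc assms(2)] by (simp only:)
qed

text \<open>One round of the approximation. Suppose words of length \<open>l\<close> represent \<open>H\<close> modulo \<open>M\<close>, and let
\<open>\<phi>(f) = [f,s]\<close>. For \<open>f = w + e\<close> with a word \<open>w\<close> and \<open>e\<close> in \<open>M\<close>, the error of \<open>\<phi>\<^sup>i(w)\<close> as an approximation of
\<open>\<phi>\<^sup>i(f)\<close> is \<open>\<phi>\<^sup>i(e)\<close>, and \<open>e = \<phi>(g)\<close> modulo \<open>P\<close> with \<open>g\<close> in \<open>H\<close>. So approximating \<open>\<phi>\<^sup>i(H)\<close> reduces to
approximating \<open>\<phi>\<^bsup>i+1\<^esup>(H)\<close>, and \<open>\<phi>\<^sup>5(H)\<close> is trivial modulo \<open>P\<close>.\<close>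

lemma commutator_approximation:
  assumes M: "subgp M" "M \<subseteq> H" and s: "s \<in> GG" "s \<in> ball S ls"
    and approx: "\<And>f. f \<in> H \<Longrightarrow> \<exists>w\<in>ball S l. cong_mod M w f"
    and into: "\<And>f. f \<in> H \<Longrightarrow> comm f s \<in> M"
    and onto: "\<And>z. z \<in> M \<Longrightarrow> \<exists>f\<in>H. cong_mod P (comm f s) z"
    and nil: "\<And>z. z \<in> M \<Longrightarrow> iter s 4 z \<in> P"
    and z: "z \<in> M"
  shows "\<exists>w\<in>ball S (30 * l + 52 * ls). cong_mod P w z"
proof -
  \<comment> \<open>words of length \<open>L\<close> approximate the image of the \<open>i\<close>-th power of \<open>f \<mapsto> [f,s]\<close>\<close>
  define A where "A i L \<longleftrightarrow> (\<forall>f\<in>H. \<exists>w\<in>ball S L. cong_mod P w (iter s i f))" for i L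
  have A5: "A (Suc 4) 0"
    unfolding A_def
  proof
    fix f assume "f \<in> H"
    then have "iter s 4 (comm f s) \<in> P" using into nil by blast
    then have "cong_mod P 0 (iter s (Suc 4) f)"
      by (simp only: funpow_Suc_right o_apply cong_mod_def minus_zero add_0)
    then show "\<exists>w\<in>ball S 0. cong_mod P w (iter s (Suc 4) f)" using ball_zero by blast
  qed
  have step: "A i (2 ^ i * l + (2 ^ (i + 1) - 2) * ls + L)" if prev: "A (Suc i) L" for i L
    unfolding A_def
  proof
    fix f assume f: "f \<in> H"
    then obtain w where w: "w \<in> ball S l" "cong_mod M w f" using approx by blast
    define e where "e = - w + f"
    have e: "e \<in> M" "f = w + e" using w by (simp_all add: e_def cong_mod_def add.assoc)
    have wH: "w \<in> H" using cong_mem[OF H(1) M(2) w(2) f] .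
    obtain g where g: "g \<in> H" "cong_mod P (comm g s) e" using onto e by blast
    obtain v where v: "v \<in> ball S L" "cong_mod P v (iter s (Suc i) g)"
      using prev g unfolding A_def by blast
    have gs: "comm g s \<in> H" using comm_in_H g s by blast
    have eH: "e \<in> H" using e M by blast
    have "iter s (Suc i) g = iter s i (comm g s)" by (simp only: funpow_Suc_right o_apply)
    then have "cong_mod P v (iter s i (comm g s))" using v(2) by (simp only:)
    then have ve: "cong_mod P v (iter s i e)"
      by (rule cong_trans[OF P(1) _ iter_cong[OF gs eH s(1) g(2)]])
    have "cong_mod P (iter s i w + iter s i e) (iter s i w + v)"
      by (rule cong_plus[OF P _ cong_refl[OF P(1)] cong_sym[OF P(1) ve]])
        (use iter_in_H[OF eH s(1)] H(3) in blast)
    then have "cong_mod P (iter s i w + v) (iter s i (w + e))"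
      by (rule cong_trans[OF P(1) cong_sym[OF P(1)] iter_hom[OF wH eH s(1)]])
    then have "cong_mod P (iter s i w + v) (iter s i f)" using e(2) by (simp only:)
    then show "\<exists>w\<in>ball S (2 ^ i * l + (2 ^ (i + 1) - 2) * ls + L). cong_mod P w (iter s i f)"
      by (rule bexI) (rule ball_plus[OF ball_iter[OF w(1) s(2)] v(1)])
  qed
  have "A (Suc 3) (16 * l + 30 * ls)" using step[OF A5] by simp
  from step[OF this] have "A (Suc 2) (8 * l + 14 * ls + (16 * l + 30 * ls))" by simp
  from step[OF this] have "A 2 (4 * l + 6 * ls + (8 * l + 14 * ls + (16 * l + 30 * ls)))"
    by simp
  from step[of 1, unfolded Suc_1, OF this] have "A 1 (2 * l + 2 * ls + (4 * l + 6 * ls + (8 * l + 14 * ls + (16 * l + 30 * ls))))"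
    by simp
  then have A1: "A 1 (30 * l + 52 * ls)" by (simp add: algebra_simps)
  obtain f where f: "f \<in> H" "cong_mod P (comm f s) z" using onto z by blast
  obtain w where "w \<in> ball S (30 * l + 52 * ls)" "cong_mod P w (comm f s)"
    using A1 f(1) unfolding A_def by auto
  then show ?thesis using f(2) cong_trans[OF P(1)] by blast
qed

end

lemma lvl_diag_plus: "y \<in> lvl n X \<Longrightarrow> diag n x + y \<in> lvl n {x + y | y. y \<in> X}"
  by (induction n arbitrary: y) (auto elim!: lvl_SucE)

text \<open>The element \<open>s\<close> is taken from the layer \<open>m = n - 2\<close> and \<open>f\<close> from the layer \<open>n - 1\<close>; the recursion for the
lengths closes because \<open>30 * 35 + 52 \<le> 35\<^sup>2\<close>. The first two layers are covered by the assumption.\<close>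

lemma layer_approximation:
  assumes base: "\<And>x. x \<in> GG \<Longrightarrow> \<exists>w\<in>ball S L. cong_mod (KL 2) w x"
  shows "x \<in> KL n \<Longrightarrow> \<exists>w\<in>ball S (L * 35 ^ n). cong_mod (KL (Suc n)) w x"
proof (induction n arbitrary: x rule: less_induct)
  case (less n)
  have "n \<le> 1 \<or> (\<exists>m. n = m + 2)" by (metis add.commute le_add_diff_inverse nat_le_linear not_less_eq_eq one_add_one plus_1_eq_Suc)
  then show ?case
  proof
    assume n: "n \<le> 1"
    obtain w where w: "w \<in> ball S L" "cong_mod (KL 2) w x" using base less.prems KL_subset_GG by blast
    have "KL 2 \<subseteq> KL (Suc n)" using n by (intro KL_antimono) simp
    moreover have "ball S L \<subseteq> ball S (L * 35 ^ n)" by (intro ball_mono) simp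
    ultimately show ?thesis using w cong_mono by blast
  next
    assume "\<exists>m. n = m + 2"
    then obtain m where n: "n = m + 2" ..
    interpret abelian_section "KL (m + 1)" "KL (m + 1 + 2)" by (rule KL_section)
    have dt: "diag m t \<in> KL m" by (rule diag_in_lvl[OF t_in_KK])
    obtain s where s: "s \<in> ball S (L * 35 ^ m)" "cong_mod (KL (Suc m)) s (diag m t)"
      using less.IH[of m, OF _ dt] n by auto
    define e where "e = - (diag m t) + s"
    have e: "e \<in> KL (Suc m)" "s = diag m t + e"
      using cong_sym[OF subgp_KL s(2)] by (simp_all add: e_def cong_mod_def add.assoc)
    have sKL: "s \<in> KL m" using cong_mem[OF subgp_KL KL_Suc_subset s(2) dt] .
    have "s \<in> lvl m {t + y | y. y \<in> KL (Suc 0)}"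
      using lvl_diag_plus[of e m "KL (Suc 0)" t] e by (simp add: lvl_add[symmetric])
    also have "\<dots> \<subseteq> lvl m (lvl (Suc 0) {s. onto s \<and> nil4 s})"
      by (rule lvl_mono) (use t_coset_onto_nil4 in blast)
    finally have good: "s \<in> lvl (m + 1) {s. onto s \<and> nil4 s}" by (simp only: lvl_add One_nat_def)
    have approx: "\<exists>w\<in>ball S (30 * (L * 35 ^ (m + 1)) + 52 * (L * 35 ^ m)). cong_mod (KL (m + 1 + 2)) w x"
    proof (rule commutator_approximation[where M = "KL (m + 2)" and s = s])
      show "KL (m + 2) \<subseteq> KL (m + 1)" by (rule KL_antimono) simp
      show "s \<in> GG" using sKL KL_subset_GG by blast
      show "\<exists>w\<in>ball S (L * 35 ^ (m + 1)). cong_mod (KL (m + 2)) w f" if "f \<in> KL (m + 1)" for f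
        using less.IH[of "m + 1", OF _ that] n by simp
      show "comm f s \<in> KL (m + 2)" if "f \<in> KL (m + 1)" for f
        using abelian_section.comm_HH[OF KL_section, of f m s] that sKL KL_Suc_subset[of m] by auto
      show "\<exists>f\<in>KL (m + 1). cong_mod (KL (m + 1 + 2)) (comm f s) z" if "z \<in> KL (m + 2)" for z
        using onto_lvl[OF good] that by simp
      show "iter s 4 z \<in> KL (m + 1 + 2)" if "z \<in> KL (m + 2)" for z
        using nil4_lvl[OF good] that by simp
    qed (use s subgp_KL less.prems n in auto)
    have "30 * (L * 35 ^ (m + 1)) + 52 * (L * 35 ^ m) \<le> L * 35 ^ n"
      by (simp add: n power_add)
    then have "ball S (30 * (L * 35 ^ (m + 1)) + 52 * (L * 35 ^ m)) \<subseteq> ball S (L * 35 ^ n)"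
      by (rule ball_mono)
    moreover obtain w where w: "w \<in> ball S (30 * (L * 35 ^ (m + 1)) + 52 * (L * 35 ^ m))"
      "cong_mod (KL (m + 1 + 2)) w x"
      using approx by (elim bexE)
    ultimately have "w \<in> ball S (L * 35 ^ n)" by (elim subsetD)
    moreover have "m + 1 + 2 = Suc n" using n by simp
    ultimately show ?thesis using w(2) by (intro bexI[of _ w]) (simp_all only:)
  qed
qed

lemma group_approximation:
  assumes base: "\<And>x. x \<in> GG \<Longrightarrow> \<exists>w\<in>ball S L. cong_mod (KL 2) w x"
    and S: "S \<subseteq> GG"
  shows "x \<in> GG \<Longrightarrow> \<exists>w\<in>ball S (2 * L * 35 ^ n). cong_mod (KL n) w x"
proof (induction n)
  case 0
  obtain w where w: "w \<in> ball S L" "cong_mod (KL 2) w x" using base 0 by blast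
  have "KL 2 \<subseteq> KL 0" by (rule KL_antimono) simp
  moreover have "ball S L \<subseteq> ball S (2 * L * 35 ^ 0)" by (intro ball_mono) simp
  ultimately show ?case using w cong_mono by blast
next
  case (Suc n)
  then obtain w where w: "w \<in> ball S (2 * L * 35 ^ n)" "cong_mod (KL n) w x" by blast
  have "- w + x \<in> KL n" using w by (simp add: cong_mod_def)
  then obtain v where v: "v \<in> ball S (L * 35 ^ n)" "cong_mod (KL (Suc n)) v (- w + x)"
    using layer_approximation[OF base] by blast
  have "cong_mod (KL (Suc n)) (w + v) x" using v(2) by (simp add: cong_mod_def add.assoc)
  moreover have "w + v \<in> ball S (2 * L * 35 ^ n + L * 35 ^ n)" by (intro ball_plus w v)
  moreover have "2 * L * 35 ^ n + L * 35 ^ n \<le> 2 * L * 35 ^ Suc n" by simp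
  ultimately show ?case using ball_mono by blast
qed

section \<open>Finite index\<close>

text \<open>In a shortest word for a coset of \<open>N\<close> the prefixes represent pairwise different cosets: otherwise
the segment between two equal ones could be cut out. So its length is at most the index of \<open>N\<close>, for
every generating set.\<close>

lemma ball_covers_cosets:
  assumes N: "subgp N" "normalized_by N GG" and S: "S \<subseteq> GG" "gen S = GG"
    and F: "finite F" "\<And>x. x \<in> GG \<Longrightarrow> \<exists>f\<in>F. cong_mod N f x"
    and x: "x \<in> GG"
  shows "\<exists>w\<in>ball S (card F). cong_mod N w x"
proof -
  let ?T = "S \<union> uminus ` S"
  have T: "?T \<subseteq> GG" using S(1) subgpD(3)[OF subgp_GG] by auto
  have TG: "sum_list ws \<in> GG" if "set ws \<subseteq> GG" for ws
    using that by (induction ws) (simp_all add: subgpD[OF subgp_GG])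
  have "x \<in> gen S" using x S by simp
  then have "\<exists>n. x \<in> ball S n"
  proof (induction)
    case gen_zero
    then show ?case using ball_zero by blast
  next
    case (gen_base x)
    then show ?case unfolding ball_def by (intro exI[of _ 1] CollectI exI[of _ "[x]"]) simp
  qed (use ball_plus ball_uminus in blast)+
  then obtain ws0 where "set ws0 \<subseteq> ?T" "cong_mod N (sum_list ws0) x"
    unfolding ball_def using cong_refl[OF N(1)] by blast
  then obtain ws where ws: "set ws \<subseteq> ?T" "cong_mod N (sum_list ws) x"
    and min: "\<And>vs. set vs \<subseteq> ?T \<Longrightarrow> cong_mod N (sum_list vs) x \<Longrightarrow> length ws \<le> length vs"
    using ex_has_least_nat[of "\<lambda>ws. set ws \<subseteq> ?T \<and> cong_mod N (sum_list ws) x" ws0 length] by blast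
  have "length ws \<le> card F"
  proof (rule ccontr)
    assume long: "\<not> length ws \<le> card F"
    have "\<exists>f\<in>F. cong_mod N f (sum_list (take i ws))" for i
      by (rule F(2), rule TG) (use ws(1) T set_take_subset[of i ws] in blast)
    then obtain \<phi> where \<phi>: "\<And>i. \<phi> i \<in> F" "\<And>i. cong_mod N (\<phi> i) (sum_list (take i ws))" by metis
    have "\<phi> ` {..length ws} \<subseteq> F" using \<phi> by blast
    moreover have "card F < card {..length ws}" using long by simp
    ultimately have "\<not> inj_on \<phi> {..length ws}" using F(1) card_inj_on_le by (metis leD)
    then obtain i j where ij: "i < j" "j \<le> length ws" "\<phi> i = \<phi> j"
      unfolding inj_on_def by (metis atMost_iff linorder_neqE_nat)
    \<comment> \<open>the word with the segment between the two equal prefixes cut out\<close>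
    let ?vs = "take i ws @ drop j ws"
    have "cong_mod N (sum_list (take i ws)) (sum_list (take j ws))"
      using \<phi>(2)[of i] \<phi>(2)[of j] ij(3) cong_trans[OF N(1)] cong_sym[OF N(1)] by metis
    moreover have "sum_list (drop j ws) \<in> GG"
      by (rule TG) (use ws(1) T set_drop_subset[of j ws] in blast)
    ultimately have "cong_mod N (sum_list ?vs) (sum_list (take j ws) + sum_list (drop j ws))"
      using cong_plus[OF N] cong_refl[OF N(1)] by simp
    moreover have "sum_list (take j ws) + sum_list (drop j ws) = sum_list ws"
      by (metis append_take_drop_id sum_list.append)
    ultimately have "cong_mod N (sum_list ?vs) x" using ws(2) cong_trans[OF N(1)] by metis
    moreover have "set ?vs \<subseteq> ?T" using ws(1) set_take_subset set_drop_subset by fastforce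
    ultimately have "length ws \<le> length ?vs" using min by blast
    then show False using ij by simp
  qed
  then show ?thesis using ws unfolding ball_def by blast
qed

text \<open>Modulo \<open>K\<close> the generator \<open>b\<close> is central, and \<open>a\<close> and \<open>d\<close> generate a dihedral group of order 8.\<close>

lemma finite_index_KK: "\<exists>F. finite F \<and> (\<forall>x\<in>GG. \<exists>f\<in>F. cong_mod KK f x)"
proof -
  \<comment> \<open>the eight alternating words in \<open>a\<close> and \<open>d\<close>; left multiplication by \<open>a\<close>, \<open>d\<close> permutes them\<close>
  define E where "E = {0, a, d, a + d, d + a, a + d + a, d + a + d, a + d + a + d}"
  define F where "F = E \<union> (+) b ` E"
  have dada: "d + (a + (d + a)) = a + (d + (a + d))"
    using word_identities(1,2) by (simp add: add.assoc)
  have dadad: "d + (a + (d + (a + d))) = a + (d + a)"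
    using dada by (metis add.assoc gen_left(4))
  have E: "a + e \<in> E" "d + e \<in> E" if "e \<in> E" for e
    using that unfolding E_def by (auto simp: add.assoc dada dadad)
  have EG: "E \<subseteq> GG" unfolding E_def by (auto intro!: subgpD[OF subgp_GG])
  define Q where "Q = {x. \<exists>f\<in>F. cong_mod KK f x}"
  have Q: "f + k \<in> Q" if "f \<in> F" "k \<in> KK" for f k
    unfolding Q_def cong_mod_def using that by force
  have Q_E: "e + k \<in> Q" "b + (e + k) \<in> Q" if "e \<in> E" "k \<in> KK" for e k
    using Q[of e k] Q[of "b + e" k] that unfolding F_def by (auto simp: add.assoc)
  have QE: "\<exists>e\<in>E. \<exists>k\<in>KK. q = e + k \<or> q = b + (e + k)" if q: "q \<in> Q" for q
  proof -
    obtain f where f: "f \<in> F" "- f + q \<in> KK" using q unfolding Q_def cong_mod_def by blast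
    consider "f \<in> E" | e where "e \<in> E" "f = b + e" using f(1) unfolding F_def by blast
    then show ?thesis
    proof cases
      case 1
      then show ?thesis using f(2) by (intro bexI[of _ f] bexI[of _ "- f + q"]) simp_all
    next
      case (2 e)
      then show ?thesis using f(2)
        by (intro bexI[of _ e] bexI[of _ "- f + q"]) (simp_all add: add.assoc)
    qed
  qed
  have left: "g + q \<in> Q" if gq: "g \<in> {a, b, d}" "q \<in> Q" for g q
  proof -
    obtain e k where e: "e \<in> E" "k \<in> KK" and q: "q = e + k \<or> q = b + (e + k)"
      using QE[OF gq(2)] by blast
    have "cj e t \<in> KK" using normalized_byD[OF normalized_KK t_in_KK] e EG by blast
    then have k': "cj e t + k \<in> KK" using subgpD(2)[OF subgp_KK] e by blast
    have 1: "a + (e + k) \<in> Q" "d + (e + k) \<in> Q" "b + (a + (e + (cj e t + k))) \<in> Q" "b + (d + (e + k)) \<in> Q"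
      using Q_E[OF E(1)[OF e(1)] e(2)] Q_E[OF E(2)[OF e(1)] e(2)] Q_E[OF E(1)[OF e(1)] k']
      by (simp_all add: add.assoc)
    \<comment> \<open>moving \<open>b\<close> past \<open>a\<close> costs a factor \<open>t\<close>, which is absorbed into \<open>K\<close> after conjugation by \<open>e\<close>\<close>
    have "b + (a + (e + (cj e t + k))) = a + (b + (e + k))"
      by (simp add: cj_def t_def add.assoc)
    moreover have "d + (b + (e + k)) = b + (d + (e + k))" by simp
    ultimately show ?thesis using gq(1) q 1 Q_E[OF e] by auto
  qed
  have "\<forall>q\<in>Q. g + q \<in> Q" if "g \<in> GG" for g
    using that
  proof (induction rule: GG_induct)
    case (gen g)
    moreover have "c + q \<in> Q" if "q \<in> Q" for q
      using left[of d q] left[of b "d + q"] that by simp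
    ultimately show ?case using left by auto
  qed (simp add: add.assoc)
  moreover have "0 \<in> Q" using Q_E(1)[of 0 0] subgpD(1)[OF subgp_KK] by (simp add: E_def)
  ultimately have "x \<in> Q" if "x \<in> GG" for x using that by (metis add_0_right)
  moreover have "finite F" by (simp add: F_def E_def)
  ultimately show ?thesis unfolding Q_def by blast
qed

lemma KK_transversal: "x \<in> KK \<Longrightarrow> \<exists>f\<in>(\<lambda>n. nmul n t) ` {..<4}. cong_mod (KL (Suc 0)) f x"
proof -
  assume "x \<in> KK"
  then obtain n where n: "cong_mod (KL (Suc 0)) (nmul n t) x" using t_exponent_exists t_exponent_def by blast
  have "nmul n t = nmul (n mod 4) t + nmul (n div 4 * 4) t" unfolding nmul_add[symmetric] by simp
  then have "cong_mod (KL (Suc 0)) (nmul (n mod 4) t) (nmul n t)"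
    using nmul_4_t by (simp add: cong_mod_def)
  then have "cong_mod (KL (Suc 0)) (nmul (n mod 4) t) x" using n cong_trans[OF subgp_KL] by blast
  then show ?thesis by (intro bexI[of _ "nmul (n mod 4) t"]) auto
qed

lemma KL_transversal: "\<exists>F. finite F \<and> (\<forall>x\<in>KL n. \<exists>f\<in>F. cong_mod (KL (Suc n)) f x)"
proof (induction n)
  case 0
  then show ?case using KK_transversal by (intro exI[of _ "(\<lambda>n. nmul n t) ` {..<4}"]) auto
next
  case (Suc n)
  then obtain F where F: "finite F" "\<And>x. x \<in> KL n \<Longrightarrow> \<exists>f\<in>F. cong_mod (KL (Suc n)) f x" by blast
  show ?case
  proof (intro exI conjI ballI)
    show "finite ((\<lambda>(x, y). pr x y) ` (F \<times> F))" using F(1) by simp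
    fix z assume "z \<in> KL (Suc n)"
    then obtain x y where z: "z = pr x y" "x \<in> KL n" "y \<in> KL n" by (auto elim: lvl_SucE)
    then obtain f g where "f \<in> F" "g \<in> F" "cong_mod (KL (Suc n)) f x" "cong_mod (KL (Suc n)) g y"
      using F(2) by blast
    then show "\<exists>f\<in>(\<lambda>(x, y). pr x y) ` (F \<times> F). cong_mod (KL (Suc (Suc n))) f z"
      by (intro bexI[of _ "pr f g"]) (auto simp: z cong_pr)
  qed
qed

lemma finite_index_KL: "\<exists>F. finite F \<and> (\<forall>x\<in>GG. \<exists>f\<in>F. cong_mod (KL n) f x)"
proof (induction n)
  case 0
  then show ?case using finite_index_KK by simp
next
  case (Suc n)
  then obtain F where F: "finite F" "\<forall>x\<in>GG. \<exists>f\<in>F. cong_mod (KL n) f x" by (elim exE conjE)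
  obtain E where E: "finite E" "\<forall>x\<in>KL n. \<exists>f\<in>E. cong_mod (KL (Suc n)) f x"
    using KL_transversal[of n] by (elim exE conjE)
  show ?case
  proof (intro exI conjI ballI)
    show "finite ((\<lambda>(x, y). x + y) ` (F \<times> E))" using F(1) E(1) by simp
    fix x assume "x \<in> GG"
    then obtain f where f: "f \<in> F" "- f + x \<in> KL n" using F(2) unfolding cong_mod_def by blast
    then obtain e where e: "e \<in> E" "cong_mod (KL (Suc n)) e (- f + x)" using E(2) by blast
    then have "cong_mod (KL (Suc n)) (f + e) x" by (simp add: cong_mod_def add.assoc)
    then show "\<exists>f\<in>(\<lambda>(x, y). x + y) ` (F \<times> E). cong_mod (KL (Suc n)) f x"
      using f e by (intro bexI[of _ "f + e"]) auto
  qed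
qed

text \<open>The constant is uniform in the generating set because the first two layers only involve the
finite quotient \<open>G/K\<^sub>2\<close>.\<close>

theorem uniform_approximation:
  "\<exists>C. \<forall>S n x. S \<subseteq> GG \<longrightarrow> gen S = GG \<longrightarrow> x \<in> GG \<longrightarrow> (\<exists>w\<in>ball S (C * 35 ^ n). cong_mod (KL n) w x)"
proof -
  obtain F where F: "finite F" "\<forall>x\<in>GG. \<exists>f\<in>F. cong_mod (KL 2) f x"
    using finite_index_KL[of 2] by (elim exE conjE)
  have "\<exists>w\<in>ball S (2 * card F * 35 ^ n). cong_mod (KL n) w x"
    if "S \<subseteq> GG" "gen S = GG" "x \<in> GG" for S n x
    using group_approximation[OF ball_covers_cosets[OF subgp_KL normalized_KL that(1,2) F(1) bspec[OF F(2)]]] that by blast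
  then show ?thesis by blast
qed


section \<open>The lower central series\<close>

fun gamma :: "nat \<Rightarrow> taut set" where
  "gamma 0 = GG"
| "gamma (Suc 0) = GG"
| "gamma (Suc (Suc n)) = gen {h + k + - h + - k | h k. h \<in> gamma (Suc n) \<and> k \<in> GG}"

lemma gamma_Suc: "n \<ge> 1 \<Longrightarrow> gamma (Suc n) = gen {h + k + - h + - k | h k. h \<in> gamma n \<and> k \<in> GG}"
  by (cases n) simp_all

lemma subgp_gamma: "subgp (gamma n)"
  by (cases n rule: gamma.cases) (simp_all add: subgp_GG subgp_gen)

lemma normalized_gamma: "normalized_by (gamma n) GG"
proof (induction n rule: gamma.induct)
  case (3 n)
  show ?case
    unfolding gamma.simps
  proof (rule normalized_gen)
    fix x g
    assume "x \<in> {h + k + - h + - k |h k. h \<in> gamma (Suc n) \<and> k \<in> GG}" and g: "g \<in> GG"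
    then obtain h k where x: "x = h + k + - h + - k" "h \<in> gamma (Suc n)" "k \<in> GG" by blast
    then have "cj g x = cj g h + cj g k + - cj g h + - cj g k" "cj g h \<in> gamma (Suc n)" "cj g k \<in> GG"
      using normalized_byD[OF 3] g cj_in[OF subgp_GG] by simp_all
    then show "cj g x \<in> gen {h + k + - h + - k |h k. h \<in> gamma (Suc n) \<and> k \<in> GG}"
      by (intro gen_base) blast
  qed
qed (auto intro!: normalized_byI cj_in[OF subgp_GG])

lemma gamma_subset_GG: "gamma n \<subseteq> GG"
proof (induction n rule: gamma.induct)
  case (3 n)
  show ?case
    unfolding gamma.simps
    by (rule gen_least[OF subgp_GG]) (use 3 in \<open>auto intro!: subgpD[OF subgp_GG]\<close>)
qed simp_all

lemma comm_in_gamma: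
  assumes "n \<ge> 1" "x \<in> gamma n" "g \<in> GG"
  shows "comm x g \<in> gamma (Suc n)"
proof -
  have "comm x g = - x + - g + - (- x) + - (- g)" by (simp add: comm_def minus_minus)
  moreover have "- x \<in> gamma n" "- g \<in> GG"
    using assms subgpD(3)[OF subgp_gamma] subgpD(3)[OF subgp_GG] by auto
  ultimately show ?thesis
    unfolding gamma_Suc[OF assms(1)] by (intro gen_base) blast
qed

lemma gamma_least:
  assumes "n \<ge> 1" "subgp N" "\<And>x g. x \<in> gamma n \<Longrightarrow> g \<in> GG \<Longrightarrow> comm x g \<in> N"
  shows "gamma (Suc n) \<subseteq> N"
  unfolding gamma_Suc[OF assms(1)]
proof (rule gen_least[OF assms(2)], clarify)
  fix h k assume hk: "h \<in> gamma n" "k \<in> GG"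
  then have "comm (- h) (- k) \<in> N"
    using subgpD(3)[OF subgp_gamma] subgpD(3)[OF subgp_GG] assms(3) by blast
  then show "h + k + - h + - k \<in> N" by (simp add: comm_def minus_minus)
qed

lemma gamma_Suc_subset: "gamma (Suc n) \<subseteq> gamma n"
proof (cases "n \<ge> 1")
  case True
  then show ?thesis
    by (rule gamma_least[OF _ subgp_gamma]) (rule comm_in_normalized[OF subgp_gamma normalized_gamma])
next
  case False
  then have "n = 0" by simp
  then show ?thesis by simp
qed

lemma gamma_antimono: "m \<le> n \<Longrightarrow> gamma n \<subseteq> gamma m"
  by (induction rule: dec_induct) (use gamma_Suc_subset in blast)+

section \<open>The branching subgroups lie deep in the lower central series\<close>

text \<open>\<open>emb n x\<close> acts by \<open>x\<close> below the leftmost vertex of level \<open>n\<close>. The elements \<open>chain m i\<close> for \<open>i < 2 ^ m\<close>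
interpolate between \<open>emb m \<tau>\<close> and \<open>diag m \<tau>\<close>, where \<open>\<tau> = t\<^sup>4 = diag 3 b\<close>: reading the binary digits of \<open>i\<close> from
the lowest one, a digit 0 keeps the left subtree only, a digit 1 doubles the element. They are the
standard basis of the \<open>G\<close>-module of functions from level \<open>m\<close> to \<open>{1, \<tau>}\<close>, adapted to its unique
composition series. As \<open>\<tau>\<close> is an involution, no signs appear and all steps below are exact.\<close>

primrec emb :: "nat \<Rightarrow> taut \<Rightarrow> taut" where
  "emb 0 x = x"
| "emb (Suc n) x = pr (emb n x) 0"

primrec chain :: "nat \<Rightarrow> nat \<Rightarrow> taut" where
  "chain 0 i = diag 3 b"
| "chain (Suc m) i = pr (chain m (i div 2)) (if even i then 0 else chain m (i div 2))"

lemma chain_uminus: "- chain m i = chain m i"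
proof (induction m arbitrary: i)
  case 0
  have "- diag n b = diag n b" for n by (induction n) simp_all
  then show ?case by simp
qed (simp add: minus_zero)

lemma chain_even: "even i \<Longrightarrow> comm (chain (Suc m) i) d = 0"
  by (subst d_pr) simp

lemma chain_odd: "odd i \<Longrightarrow> comm (chain (Suc m) i) a = 0"
  by (simp add: comm_cj)

lemma chain_step_even:
  assumes "even i" "Suc i < 2 ^ m"
  shows "comm (chain m i) a = chain m (Suc i)"
proof (cases m)
  case (Suc k)
  have "Suc i div 2 = i div 2" using assms(1) by simp
  then show ?thesis using assms(1) by (simp add: Suc comm_cj chain_uminus minus_zero)
qed (use assms in simp)

lemma lift_bcd: "g \<in> {b, c, d} \<Longrightarrow> \<exists>h\<in>{b, c, d}. \<exists>y\<in>{0, a}. h = pr y g"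
proof (elim insertE emptyE)
  show "g = b \<Longrightarrow> ?thesis" by (rule bexI[of _ d], rule bexI[of _ 0]) (simp_all add: d_pr[symmetric])
  show "g = c \<Longrightarrow> ?thesis" by (rule bexI[of _ b], rule bexI[of _ a]) (simp_all add: b_pr[symmetric])
  show "g = d \<Longrightarrow> ?thesis" by (rule bexI[of _ c], rule bexI[of _ a]) (simp_all add: c_pr[symmetric])
qed

text \<open>An odd element is \<open>pr x x\<close>, and one coordinate must make a step while the other returns to 0. If
the step of \<open>x\<close> is by \<open>a\<close>, then \<open>x\<close> commutes with \<open>d\<close>, and \<open>c = pr a d\<close> does it. If it is by \<open>b\<close>, \<open>c\<close> or \<open>d\<close>, then \<open>x\<close>
commutes with \<open>a\<close>, and the lift from \<open>lift_bcd\<close> does it, on the wrong side; hence the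
conjugation by \<open>u\<close>.\<close>

lemma chain_step_odd:
  "odd i \<Longrightarrow> Suc i < 2 ^ m \<Longrightarrow> \<exists>g\<in>{b, c, d}. \<exists>u\<in>GG. cj u (comm (chain m i) g) = chain m (Suc i)"
proof (induction m arbitrary: i)
  case (Suc k)
  let ?j = "i div 2"
  have j: "Suc i div 2 = Suc ?j" "Suc ?j < 2 ^ k" using Suc.prems by (auto elim: oddE)
  let ?x = "chain k ?j"
  have i: "chain (Suc k) i = pr ?x ?x" "chain (Suc k) (Suc i) = pr (chain k (Suc ?j)) 0"
    using Suc.prems(1) j(1) by simp_all
  obtain l where l: "k = Suc l" using j(2) by (cases k) auto
  show ?case
  proof (cases "even ?j")
    case True
    have "comm (pr ?x ?x) (pr a d) = pr (chain k (Suc ?j)) 0"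
      using chain_step_even[OF True j(2)] chain_even[OF True] l by (simp del: chain.simps)
    then show ?thesis
      unfolding i c_pr[symmetric] by (intro bexI[of _ c] bexI[of _ 0]) (simp_all add: subgpD[OF subgp_GG])
  next
    case False
    then obtain g u where g: "g \<in> {b, c, d}" and u: "u \<in> GG" and gu: "cj u (comm ?x g) = chain k (Suc ?j)"
      using Suc.IH j(2) by blast
    obtain y where y: "pr u y \<in> GG" using self_replicating u by blast
    have xa: "comm ?x a = 0" "comm ?x 0 = 0" using chain_odd False l by (simp_all del: chain.simps)
    obtain h y' where "h \<in> {b, c, d}" "y' \<in> {0, a}" "h = pr y' g" using lift_bcd[OF g] by blast
    then have "h \<in> {b, c, d} \<and> comm (pr ?x ?x) h = pr 0 (comm ?x g)" using xa by auto
    then obtain h where h: "h \<in> {b, c, d}" "comm (pr ?x ?x) h = pr 0 (comm ?x g)" by blast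
    have "cj (a + pr u y) (comm (pr ?x ?x) h) = pr (chain k (Suc ?j)) 0"
      unfolding h(2) using gu by (simp del: a_pr)
    moreover have "a + pr u y \<in> GG" by (intro subgpD(2)[OF subgp_GG] y gens_in_GG)
    ultimately show ?thesis unfolding i using h(1) by blast
  qed
qed simp

lemma chain_step:
  assumes "c0 \<ge> 1" "Suc i < 2 ^ m" "chain m i \<in> gamma c0"
  shows "chain m (Suc i) \<in> gamma (Suc c0)"
proof (cases "even i")
  case True
  then show ?thesis using comm_in_gamma[OF assms(1,3), of a] chain_step_even[OF True assms(2)] by simp
next
  case False
  then obtain g u where g: "g \<in> {b, c, d}" and u: "u \<in> GG" "cj u (comm (chain m i) g) = chain m (Suc i)"
    using chain_step_odd assms(2) by blast
  have "g \<in> GG" using g by auto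
  then have "comm (chain m i) g \<in> gamma (Suc c0)" using comm_in_gamma[OF assms(1,3)] by blast
  then show ?thesis using u normalized_byD[OF normalized_gamma] by metis
qed

lemma chain_in_gamma:
  "c0 \<ge> 1 \<Longrightarrow> i < 2 ^ m \<Longrightarrow> chain m 0 \<in> gamma c0 \<Longrightarrow> chain m i \<in> gamma (c0 + i)"
  by (induction i) (use chain_step[of "c0 + i" for i] in auto)

lemma chain_0: "chain m 0 = emb m (diag 3 b)"
  by (induction m) simp_all

lemma chain_last: "chain m (2 ^ m - 1) = diag m (diag 3 b)"
proof (induction m)
  case (Suc m)
  have "odd (2 ^ Suc m - 1 :: nat)" "(2 ^ Suc m - 1) div 2 = (2 ^ m - 1 :: nat)"
    using one_le_power[of "2::nat" m] by auto
  then show ?case using Suc by simp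
qed simp

lemma emb_in_KL: "x \<in> KK \<Longrightarrow> emb n x \<in> KL n"
  by (induction n) (simp_all add: subgpD[OF subgp_KL])

lemma diag_b_in_gamma:
  assumes "c0 \<ge> 1" "KL m \<subseteq> gamma c0"
  shows "diag (m + 3) b \<in> gamma (c0 + (2 ^ m - 1))"
proof -
  have "diag 3 b \<in> KK" using t_fourth t_in_KK subgpD(2)[OF subgp_KK] by metis
  then have "chain m 0 \<in> gamma c0" using assms(2) emb_in_KL chain_0 by auto
  then have "chain m (2 ^ m - 1) \<in> gamma (c0 + (2 ^ m - 1))" by (intro chain_in_gamma assms(1)) simp_all
  then show ?thesis by (simp only: chain_last diag_add)
qed

text \<open>The inverse of \<open>t\<close> at one vertex of level \<open>n + 1\<close>: the left child of the rightmost vertex of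
level \<open>n\<close>.\<close>

primrec spot :: "nat \<Rightarrow> taut" where
  "spot 0 = pr (- t) 0"
| "spot (Suc n) = pr 0 (spot n)"

text \<open>Some \<open>g\<close> among \<open>b\<close>, \<open>c\<close>, \<open>d\<close> has the section \<open>a\<close> at the vertex of \<open>spot n\<close>. Its other sections at level
\<open>n + 1\<close>, up to permutations of subtrees, are trivial or among \<open>b\<close>, \<open>c\<close>, \<open>d\<close>, and these commute with \<open>b\<close>.\<close>

lemma comm_diag_b: "\<exists>g\<in>{b, c, d}. comm (diag (Suc n) b) g = spot n"
proof (induction n)
  case 0
  have "comm b a = - t" "comm b c = 0" by (simp_all add: comm_def t_def add.assoc)
  then have "comm (diag (Suc 0) b) (pr a c) = spot 0" by simp
  then have "comm (diag (Suc 0) b) b = spot 0" by (simp only: b_pr[symmetric])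
  then show ?case by blast
next
  case (Suc n)
  then obtain g where g: "g \<in> {b, c, d}" "comm (diag (Suc n) b) g = spot n" by blast
  have "comm (diag (Suc n) b) a = 0" by (simp add: comm_cj)
  then have *: "comm (diag (Suc (Suc n)) b) (pr y g) = spot (Suc n)" if "y \<in> {0, a}" for y
    using that g(2) by (auto simp: diag.simps(2)[of "Suc n"] simp del: diag.simps)
  obtain h y where h: "h \<in> {b, c, d}" and "y \<in> {0, a}" "h = pr y g"
    using lift_bcd[OF g(1)] by (elim bexE)
  then have "comm (diag (Suc (Suc n)) b) h = spot (Suc n)" using * by (simp only:)
  then show ?case using h by (rule bexI)
qed

lemma KL_subset_of_spot: "subgp N \<Longrightarrow> normalized_by N GG \<Longrightarrow> spot n \<in> N \<Longrightarrow> KL (Suc n) \<subseteq> N"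
proof (induction n arbitrary: N)
  case 0
  have "- spot 0 \<in> N" by (rule subgpD(3)[OF 0(1,3)])
  with 0 have "KK \<subseteq> {x. pr x 0 \<in> N}"
    by (intro KK_least left_section_subgroup) (simp_all add: minus_minus minus_zero)
  then show ?case using lvl_Suc_subset_of_left[OF 0(1,2), of 0 KK] by simp
next
  case (Suc n)
  have "cj a (spot (Suc n)) \<in> N" by (rule normalized_byD[OF Suc.prems(2,3) gens_in_GG(1)])
  then have "pr (spot n) 0 \<in> N" by simp
  then have "KL (Suc n) \<subseteq> {x. pr x 0 \<in> N}"
    using Suc.IH[OF left_section_subgroup[OF Suc.prems(1,2)]] by blast
  then show ?case by (rule lvl_Suc_subset_of_left[OF Suc.prems(1,2)])
qed

text \<open>From \<open>emb m \<tau>\<close> it takes \<open>2\<^sup>m - 1\<close> commutators to reach \<open>diag m \<tau> = diag (m + 3) b\<close>, and one more to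
reach an element whose normal closure contains \<open>K\<^bsub>m+3\<^esub>\<close>.\<close>

lemma KL_subset_gamma_step:
  assumes "c0 \<ge> 1" "KL m \<subseteq> gamma c0"
  shows "KL (m + 3) \<subseteq> gamma (c0 + 2 ^ m)"
proof -
  obtain g where g: "g \<in> {b, c, d}" "comm (diag (Suc (m + 2)) b) g = spot (m + 2)"
    using comm_diag_b by blast
  then have gG: "g \<in> GG" by auto
  have "diag (Suc (m + 2)) b \<in> gamma (c0 + (2 ^ m - 1))"
    using diag_b_in_gamma[OF assms] by (simp add: numeral_eq_Suc)
  then have "comm (diag (Suc (m + 2)) b) g \<in> gamma (Suc (c0 + (2 ^ m - 1)))"
    by (rule comm_in_gamma[OF trans_le_add1[OF assms(1)] _ gG])
  then have "spot (m + 2) \<in> gamma (Suc (c0 + (2 ^ m - 1)))" by (simp only: g(2))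
  then have "spot (m + 2) \<in> gamma (c0 + 2 ^ m)" by simp
  then show ?thesis
    using KL_subset_of_spot[OF subgp_gamma normalized_gamma] by (simp add: numeral_eq_Suc)
qed

text \<open>The steps add up to \<open>1 + 8 + 8\<^sup>2 + \<dots>\<close>, of which only the last term is kept.\<close>

lemma KL_subset_gamma: "KL (3 * k) \<subseteq> gamma (8 ^ k div 8 + 1)"
proof (induction k)
  case 0
  then show ?case using KK_subset_GG by simp
next
  case (Suc k)
  have "KL (3 * k + 3) \<subseteq> gamma (8 ^ k div 8 + 1 + 2 ^ (3 * k))"
    by (rule KL_subset_gamma_step[OF _ Suc]) simp
  also have "\<dots> \<subseteq> gamma (8 ^ Suc k div 8 + 1)"
    by (rule gamma_antimono) (simp add: power_mult)
  finally show ?case by (simp add: algebra_simps)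
qed

section \<open>The lower central series is strictly decreasing\<close>

text \<open>An element of \<open>G\<close> that fixes level \<open>m\<close> defines a function on the vertices of that level with values in
the field with two elements, recording which pairs of children it swaps. The \<open>G\<close>-module of all
such functions has a unique composition series, and \<open>Lev m i\<close> is the preimage of its \<open>i\<close>-th term: \<open>Lev m 0\<close> is
the stabilizer of level \<open>m\<close>, and \<open>Lev m (2 ^ m)\<close> that of level \<open>m + 1\<close>. The recursion describes the series
through the two subtrees: one step down makes the two components agree modulo the next term,
the following one moves both of them into it.\<close>

fun Lev :: "nat \<Rightarrow> nat \<Rightarrow> taut set" where
  "Lev 0 0 = GG"
| "Lev 0 (Suc i) = {g \<in> GG. \<exists>x\<in>GG. \<exists>y\<in>GG. g = pr x y}"
| "Lev (Suc m) i = {g \<in> GG. \<exists>x\<in>Lev m (i div 2). \<exists>y\<in>Lev m (i div 2).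
     g = pr x y \<and> (odd i \<longrightarrow> x + y \<in> Lev m (i div 2 + 1))}"

declare Lev.simps [simp del]

lemma Lev_SucI:
  assumes "pr x y \<in> GG" "x \<in> Lev m (i div 2)" "y \<in> Lev m (i div 2)"
    "odd i \<Longrightarrow> x + y \<in> Lev m (i div 2 + 1)"
  shows "pr x y \<in> Lev (Suc m) i"
  using assms by (auto simp: Lev.simps)

lemma Lev_SucE:
  assumes "z \<in> Lev (Suc m) i"
  obtains x y where "z = pr x y" "pr x y \<in> GG" "x \<in> Lev m (i div 2)" "y \<in> Lev m (i div 2)"
    "odd i \<Longrightarrow> x + y \<in> Lev m (i div 2 + 1)"
  using assms by (auto simp: Lev.simps)

lemma Lev_subset_GG: "Lev m i \<subseteq> GG"
  by (cases "(m, i)" rule: Lev.cases) (auto simp: Lev.simps)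

text \<open>The induction on \<open>m\<close> needs all of these at once. In particular doubling must go down, as the
difference of two components that agree modulo the next term is their sum up to a double.\<close>

definition Lev_ok :: "nat \<Rightarrow> nat \<Rightarrow> bool" where
  "Lev_ok m i \<longleftrightarrow> subgp (Lev m i) \<and> normalized_by (Lev m i) GG \<and>
    (i < 2 ^ m \<longrightarrow> Lev m (Suc i) \<subseteq> Lev m i \<and>
      (\<forall>x\<in>Lev m i. x + x \<in> Lev m (Suc i)) \<and> (\<forall>x\<in>Lev m i. \<forall>g\<in>GG. comm x g \<in> Lev m (Suc i)))"

lemma normalized_by_GG_cases:
  assumes "N \<subseteq> GG" "\<And>x. x \<in> N \<Longrightarrow> cj a x \<in> N"
    "\<And>x g h. x \<in> N \<Longrightarrow> g \<in> GG \<Longrightarrow> h \<in> GG \<Longrightarrow> pr g h \<in> GG \<Longrightarrow> cj (pr g h) x \<in> N"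
  shows "normalized_by N GG"
proof (rule normalized_byI)
  fix x g assume x: "x \<in> N" and g: "g \<in> GG"
  show "cj g x \<in> N"
  proof (cases rule: GG_cases[OF g])
    case (1 u v)
    then show ?thesis using assms(3)[OF x] g by blast
  next
    case (2 u v)
    have "g + a \<in> GG" using g by (intro subgpD(2)[OF subgp_GG] gens_in_GG)
    then have "pr u v \<in> GG" using 2 by (simp add: add.assoc)
    then have "cj (pr u v) x \<in> N" using assms(3)[OF x] 2 by blast
    then show ?thesis using assms(2) 2 by simp
  qed
qed

lemma Lev_ok_0: "i \<le> 1 \<Longrightarrow> Lev_ok 0 i"
proof -
  let ?St = "Lev 0 (Suc 0)"
  have StI: "pr x y \<in> ?St" if "pr x y \<in> GG" "x \<in> GG" "y \<in> GG" for x y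
    using that by (auto simp: Lev.simps)
  have StE: "\<exists>x\<in>GG. \<exists>y\<in>GG. z = pr x y \<and> pr x y \<in> GG" if "z \<in> ?St" for z
    using that by (auto simp: Lev.simps)
  note G = subgpD[OF subgp_GG]
  have sub: "subgp ?St"
  proof (rule subgpI)
    show "0 \<in> ?St" using StI[of 0 0] G by simp
    show "x + y \<in> ?St" if xy: "x \<in> ?St" "y \<in> ?St" for x y
    proof -
      obtain x0 x1 y0 y1 where "x0 \<in> GG" "x1 \<in> GG" "y0 \<in> GG" "y1 \<in> GG"
        "x = pr x0 x1" "y = pr y0 y1" "x \<in> GG" "y \<in> GG"
        using StE[OF xy(1)] StE[OF xy(2)] by blast
      then show ?thesis using StI[of "x0 + y0" "x1 + y1"] G(2)[of x y] G(2) by simp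
    qed
    show "- x \<in> ?St" if x: "x \<in> ?St" for x
    proof -
      obtain x0 x1 where "x0 \<in> GG" "x1 \<in> GG" "x = pr x0 x1" "x \<in> GG"
        using StE[OF x] by blast
      then show ?thesis using StI[of "- x0" "- x1"] G(3)[of x] G(3) by simp
    qed
  qed
  have norm: "normalized_by ?St GG"
  proof (rule normalized_by_GG_cases[OF Lev_subset_GG])
    fix x assume x: "x \<in> ?St"
    then obtain x0 x1 where *: "x0 \<in> GG" "x1 \<in> GG" "x = pr x0 x1" "x \<in> GG"
      using StE by blast
    then have "cj a x \<in> GG" by (intro cj_in[OF subgp_GG] gens_in_GG)
    then show "cj a x \<in> ?St" using * StI by simp
    fix g h assume gh: "g \<in> GG" "h \<in> GG" "pr g h \<in> GG"
    then have "cj (pr g h) x \<in> GG" using * by (intro cj_in[OF subgp_GG])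
    then show "cj (pr g h) x \<in> ?St" using * gh StI cj_in[OF subgp_GG] by simp
  qed
  have in_St: "x \<in> ?St" if "x \<in> GG" "x = pr u v" "u \<in> GG" "v \<in> GG" for x u v
    using that StI by simp
  have dbl: "x + x \<in> ?St" if x: "x \<in> GG" for x
  proof (cases rule: GG_cases[OF x])
    case (1 u v)
    then show ?thesis using in_St[OF G(2)[OF x x]] G(2) by simp
  next
    case (2 u v)
    then have "x + x = pr (u + v) (v + u)" by (simp add: add.assoc)
    then show ?thesis using in_St[OF G(2)[OF x x]] 2 G(2) by simp
  qed
  have com: "comm x g \<in> ?St" if x: "x \<in> GG" and g: "g \<in> GG" for x g
  proof -
    \<comment> \<open>a commutator is a product of three squares, and squares fix the first level\<close>
    have "comm x g = (- x + - x) + ((x + - g) + (x + - g)) + (g + g)"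
      by (simp add: comm_def add.assoc)
    moreover have "- x \<in> GG" "x + - g \<in> GG" using x g G by simp_all
    ultimately show ?thesis using dbl g subgpD(2)[OF sub] by simp
  qed
  have G0: "Lev 0 0 = GG" by (simp add: Lev.simps)
  have "normalized_by GG GG" by (rule normalized_byI) (rule cj_in[OF subgp_GG])
  then have "Lev_ok 0 0" unfolding Lev_ok_def G0 using subgp_GG dbl com Lev_subset_GG by blast
  moreover have "Lev_ok 0 1" using sub norm by (simp add: Lev_ok_def)
  moreover assume "i \<le> 1"
  ultimately show "Lev_ok 0 i" by (cases i) auto
qed

lemma Lev_ok_Suc:
  assumes IH: "\<And>j. j \<le> 2 ^ m \<Longrightarrow> Lev_ok m j"
  shows "i \<le> 2 ^ Suc m \<Longrightarrow> Lev_ok (Suc m) i"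
proof -
  note G = subgpD[OF subgp_GG]
  have S: "subgp (Lev m j)" and N: "normalized_by (Lev m j) GG" if "j \<le> 2 ^ m" for j
    using IH[OF that] by (simp_all add: Lev_ok_def)
  have down: "Lev m (Suc j) \<subseteq> Lev m j" and dbl: "\<And>x. x \<in> Lev m j \<Longrightarrow> x + x \<in> Lev m (Suc j)"
    and com: "\<And>x g. x \<in> Lev m j \<Longrightarrow> g \<in> GG \<Longrightarrow> comm x g \<in> Lev m (Suc j)" if "j < 2 ^ m" for j
    using IH[of j] that by (simp_all add: Lev_ok_def)
  have sub: "subgp (Lev (Suc m) i) \<and> normalized_by (Lev (Suc m) i) GG" if i: "i \<le> 2 ^ Suc m" for i
  proof -
    let ?j = "i div 2"
    have j: "?j \<le> 2 ^ m" "odd i \<Longrightarrow> ?j < 2 ^ m" using i by (auto elim!: oddE)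
    note Sj = subgpD[OF S[OF j(1)]]
    have Sj': "subgp (Lev m (Suc ?j))" "normalized_by (Lev m (Suc ?j)) GG" if "odd i"
      using S[of "Suc ?j"] N[of "Suc ?j"] j(2)[OF that] by simp_all
    have inG: "x \<in> GG" if "x \<in> Lev m k" for x k using that Lev_subset_GG by blast
    have flip: "y + x \<in> Lev m (Suc ?j)" if "odd i" "x + y \<in> Lev m (Suc ?j)" "x \<in> GG" for x y
      using normalized_byD[OF Sj'(2)[OF that(1)] that(2,3)] by (simp add: cj_def add.assoc)
    have cjs: "cj g x + cj h y \<in> Lev m (Suc ?j)"
      if "odd i" "x + y \<in> Lev m (Suc ?j)" "x \<in> Lev m ?j" "y \<in> Lev m ?j" "g \<in> GG" "h \<in> GG" for x y g h
    proof -
      have "cj y (comm x g) \<in> Lev m (Suc ?j)"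
        by (rule normalized_byD[OF Sj'(2)[OF that(1)] com[OF j(2)[OF that(1)] that(3,5)] inG[OF that(4)]])
      then have "(x + y) + (cj y (comm x g) + comm y h) \<in> Lev m (Suc ?j)"
        using com[OF j(2)[OF that(1)] that(4,6)] that(2) subgpD(2)[OF Sj'(1)[OF that(1)]] by blast
      then show ?thesis by (simp add: comm_def cj_def add.assoc)
    qed
    have "subgp (Lev (Suc m) i)"
    proof (rule subgpI)
      have "pr 0 0 \<in> Lev (Suc m) i"
        by (rule Lev_SucI) (use G Sj subgpD(1)[OF Sj'(1)] in auto)
      then show "0 \<in> Lev (Suc m) i" by simp
    next
      fix z w assume "z \<in> Lev (Suc m) i" "w \<in> Lev (Suc m) i"
      then obtain x y x' y' where z: "z = pr x y" "pr x y \<in> GG" "x \<in> Lev m ?j" "y \<in> Lev m ?j"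
        "odd i \<Longrightarrow> x + y \<in> Lev m (?j + 1)"
        and w: "w = pr x' y'" "pr x' y' \<in> GG" "x' \<in> Lev m ?j" "y' \<in> Lev m ?j"
        "odd i \<Longrightarrow> x' + y' \<in> Lev m (?j + 1)" by (elim Lev_SucE) blast
      have "pr (x + x') (y + y') \<in> Lev (Suc m) i"
      proof (rule Lev_SucI)
        show "pr (x + x') (y + y') \<in> GG" using G(2)[OF z(2) w(2)] by simp
        show "x + x' \<in> Lev m ?j" "y + y' \<in> Lev m ?j" using z w Sj by blast+
        assume o: "odd i"
        \<comment> \<open>the components have to be reordered, which is free modulo the next term\<close>
        have "comm y (- x') \<in> Lev m (Suc ?j)" using com[OF j(2)[OF o] z(4)] G(3) inG w(3) by blast
        then have "(x + y) + comm y (- x') + (x' + y') \<in> Lev m (Suc ?j)"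
          using z(5)[OF o] w(5)[OF o] subgpD(2)[OF Sj'(1)[OF o]] by simp
        then show "x + x' + (y + y') \<in> Lev m (?j + 1)"
          by (simp add: comm_def add.assoc minus_minus)
      qed
      then show "z + w \<in> Lev (Suc m) i" by (simp add: z w)
    next
      fix z assume "z \<in> Lev (Suc m) i"
      then obtain x y where z: "z = pr x y" "pr x y \<in> GG" "x \<in> Lev m ?j" "y \<in> Lev m ?j"
        "odd i \<Longrightarrow> x + y \<in> Lev m (?j + 1)" by (elim Lev_SucE) blast
      have "pr (- x) (- y) \<in> Lev (Suc m) i"
      proof (rule Lev_SucI)
        show "pr (- x) (- y) \<in> GG" using G(3)[OF z(2)] by simp
        show "- x \<in> Lev m ?j" "- y \<in> Lev m ?j" using z Sj by blast+
        assume o: "odd i"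
        have "- (y + x) \<in> Lev m (Suc ?j)"
          using flip[OF o _ inG[OF z(3)]] z(5)[OF o] subgpD(3)[OF Sj'(1)[OF o]] by (simp del: minus_add)
        then show "- x + - y \<in> Lev m (?j + 1)" by simp
      qed
      then show "- z \<in> Lev (Suc m) i" by (simp add: z)
    qed
    moreover have "normalized_by (Lev (Suc m) i) GG"
    proof (rule normalized_by_GG_cases[OF Lev_subset_GG])
      fix z assume "z \<in> Lev (Suc m) i"
      then obtain x y where z: "z = pr x y" "pr x y \<in> GG" "x \<in> Lev m ?j" "y \<in> Lev m ?j"
        "odd i \<Longrightarrow> x + y \<in> Lev m (?j + 1)" by (elim Lev_SucE) blast
      have "pr y x \<in> Lev (Suc m) i"
      proof (rule Lev_SucI[OF _ z(4,3)])
        show "pr y x \<in> GG" using cj_in[OF subgp_GG gens_in_GG(1) z(2)] by simp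
        show "y + x \<in> Lev m (?j + 1)" if "odd i"
          using flip[OF that _ inG[OF z(3)]] z(5)[OF that] by simp
      qed
      then show "cj a z \<in> Lev (Suc m) i" by (simp add: z)
      fix g h assume gh: "g \<in> GG" "h \<in> GG" "pr g h \<in> GG"
      have "pr (cj g x) (cj h y) \<in> Lev (Suc m) i"
      proof (rule Lev_SucI)
        show "pr (cj g x) (cj h y) \<in> GG" using cj_in[OF subgp_GG gh(3) z(2)] by simp
        show "cj g x \<in> Lev m ?j" "cj h y \<in> Lev m ?j" using z gh normalized_byD[OF N[OF j(1)]] by blast+
        show "cj g x + cj h y \<in> Lev m (?j + 1)" if "odd i" using cjs[OF that] z gh that by simp
      qed
      then show "cj (pr g h) z \<in> Lev (Suc m) i" by (simp add: z)
    qed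
    ultimately show ?thesis ..
  qed
  assume i: "i \<le> 2 ^ Suc m"
  let ?j = "i div 2"
  have more: "Lev (Suc m) (Suc i) \<subseteq> Lev (Suc m) i \<and>
      (\<forall>z\<in>Lev (Suc m) i. z + z \<in> Lev (Suc m) (Suc i)) \<and> (\<forall>z\<in>Lev (Suc m) i. \<forall>g\<in>GG. comm z g \<in> Lev (Suc m) (Suc i))"
    if i: "i < 2 ^ Suc m"
  proof -
    have j: "?j < 2 ^ m" "?j \<le> 2 ^ m" using i by auto
    note Sj = subgpD[OF S[OF j(2)]]
    have Sj': "subgp (Lev m (Suc ?j))" using S[of "Suc ?j"] j by simp
    have next_mem: "pr x y \<in> Lev (Suc m) (Suc i)"
      if "pr x y \<in> GG" "x \<in> Lev m (Suc ?j)" "y \<in> Lev m (Suc ?j)" for x y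
    proof (rule Lev_SucI[OF that(1)])
      have "Suc i div 2 = ?j \<or> Suc i div 2 = Suc ?j" by linarith
      then show "x \<in> Lev m (Suc i div 2)" "y \<in> Lev m (Suc i div 2)" using that down[OF j(1)] by auto
      assume "odd (Suc i)"
      then have "Suc i div 2 = ?j" by simp
      then show "x + y \<in> Lev m (Suc i div 2 + 1)" using that subgpD(2)[OF Sj'] by simp
    qed
    have "Lev (Suc m) (Suc i) \<subseteq> Lev (Suc m) i"
    proof
      fix z assume "z \<in> Lev (Suc m) (Suc i)"
      then obtain x y where z: "z = pr x y" "pr x y \<in> GG" "x \<in> Lev m (Suc i div 2)" "y \<in> Lev m (Suc i div 2)"
        "odd (Suc i) \<Longrightarrow> x + y \<in> Lev m (Suc i div 2 + 1)" by (elim Lev_SucE) blast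
      show "z \<in> Lev (Suc m) i"
      proof (cases "odd i")
        case True
        then have "Suc i div 2 = Suc ?j" by (auto elim: oddE)
        then show ?thesis unfolding z(1) using z down[OF j(1)] subgpD(2)[OF Sj'] by (intro Lev_SucI) auto
      next
        case False
        then have "Suc i div 2 = ?j" by simp
        then show ?thesis unfolding z(1) using z False by (intro Lev_SucI) auto
      qed
    qed
    moreover have "z + z \<in> Lev (Suc m) (Suc i)" if "z \<in> Lev (Suc m) i" for z
    proof -
      obtain x y where z: "z = pr x y" "pr x y \<in> GG" "x \<in> Lev m ?j" "y \<in> Lev m ?j"
        using \<open>z \<in> Lev (Suc m) i\<close> by (elim Lev_SucE) blast
      have "pr (x + x) (y + y) \<in> Lev (Suc m) (Suc i)"
        using next_mem dbl[OF j(1)] z G(2)[OF z(2) z(2)] by simp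
      then show ?thesis by (simp add: z)
    qed
    moreover have "comm z g \<in> Lev (Suc m) (Suc i)" if "z \<in> Lev (Suc m) i" and g: "g \<in> GG" for z g
    proof -
      obtain x y where z: "z = pr x y" "pr x y \<in> GG" "x \<in> Lev m ?j" "y \<in> Lev m ?j"
        and o: "odd i \<Longrightarrow> x + y \<in> Lev m (?j + 1)"
        using \<open>z \<in> Lev (Suc m) i\<close> by (elim Lev_SucE) blast
      have pr_case: "comm z (pr u v) \<in> Lev (Suc m) (Suc i)" if "pr u v \<in> GG" "u \<in> GG" "v \<in> GG" for u v
        using next_mem[of "comm x u" "comm y v"] com[OF j(1)] z that comm_in[OF subgp_GG z(2) that(1)] by simp
      have "comm (pr x y) a \<in> GG" by (rule comm_in[OF subgp_GG z(2) gens_in_GG(1)])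
      then have zaG: "pr (- x + y) (- y + x) \<in> GG" by (simp add: comm_cj)
      have "pr (- x + y) (- y + x) \<in> Lev (Suc m) (Suc i)"
      proof (cases "odd i")
        case True
        \<comment> \<open>here doubling enters: it turns the known sum into the difference\<close>
        have "- (x + x) + (x + y) \<in> Lev m (Suc ?j)"
          using o[OF True] dbl[OF j(1) z(3)] subgpD(2,3)[OF Sj'] by (simp del: minus_add)
        then have "- x + y \<in> Lev m (Suc ?j)" by (simp add: add.assoc)
        moreover from subgpD(3)[OF Sj' this] have "- y + x \<in> Lev m (Suc ?j)" by (simp add: minus_minus)
        ultimately show ?thesis using next_mem zaG by blast
      next
        case False
        then have "Suc i div 2 = ?j" by simp
        then show ?thesis using zaG z Sj subgpD(1)[OF Sj'] by (intro Lev_SucI) (auto simp: add.assoc)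
      qed
      then have a_case: "comm z a \<in> Lev (Suc m) (Suc i)" by (simp add: comm_cj z)
      have SI: "subgp (Lev (Suc m) (Suc i))" "normalized_by (Lev (Suc m) (Suc i)) GG"
        using sub[of "Suc i"] i by simp_all
      show ?thesis
      proof (cases rule: GG_cases[OF g])
        case (1 u v)
        then show ?thesis using pr_case g by simp
      next
        case (2 u v)
        have "g + a \<in> GG" using g by (intro G(2) gens_in_GG)
        then have "pr u v \<in> GG" using 2 by (simp add: add.assoc)
        then have "cj a (comm z (pr u v)) \<in> Lev (Suc m) (Suc i)"
          by (intro normalized_byD[OF SI(2)] pr_case gens_in_GG 2)
        then show ?thesis
          unfolding 2(3) comm_plus_right using a_case subgpD(2)[OF SI(1)] by blast
      qed
    qed
    ultimately show ?thesis by blast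
  qed
  show "Lev_ok (Suc m) i"
    unfolding Lev_ok_def using sub[OF i] more by blast
qed

lemma Lev_ok: "i \<le> 2 ^ m \<Longrightarrow> Lev_ok m i"
proof (induction m arbitrary: i)
  case 0
  then show ?case using Lev_ok_0 by simp
next
  case (Suc m)
  then show ?case using Lev_ok_Suc by blast
qed

lemma Lev_top: "Lev m (2 ^ m) \<subseteq> Lev (Suc m) 0"
proof (induction m)
  case 0
  then show ?case by (auto simp: Lev.simps)
next
  case (Suc m)
  show ?case
  proof
    fix z assume "z \<in> Lev (Suc m) (2 ^ Suc m)"
    then obtain x y where "z = pr x y" "pr x y \<in> GG" "x \<in> Lev m (2 ^ m)" "y \<in> Lev m (2 ^ m)"
      by (elim Lev_SucE) simp
    then show "z \<in> Lev (Suc (Suc m)) 0" using Suc by (auto intro!: Lev_SucI)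
  qed
qed

lemma Lev_act: "x \<in> Lev m 0 \<Longrightarrow> length w \<le> m \<Longrightarrow> act x w = w"
proof (induction m arbitrary: x w)
  case 0
  have "act x [] = []" if "x \<in> GG" for x
    using that by (induction rule: GG_induct) (auto simp: a.rep_eq b.rep_eq c.rep_eq d.rep_eq)
  then show ?case using 0 by (simp add: Lev.simps)
next
  case (Suc m)
  obtain y z where x: "x = pr y z" "y \<in> Lev m 0" "z \<in> Lev m 0" using Suc.prems(1) by (elim Lev_SucE) simp
  show ?case
    using Suc.IH[OF x(2)] Suc.IH[OF x(3)] Suc.prems(2)
    by (cases w rule: grig_a.cases) (simp_all add: x(1))
qed

lemma diag_t_nonzero: "diag n t \<noteq> 0"
  by (induction n) (simp_all add: t_nonzero)

lemma KL_subset_gamma_ex: "\<exists>k. KL k \<subseteq> gamma n"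
proof -
  have "n < 2 ^ n" by (rule less_exp)
  also have "(2 :: nat) ^ n \<le> 8 ^ n" by (rule power_mono) simp_all
  finally have "n \<le> 8 ^ Suc n div 8 + 1" by simp
  then have "KL (3 * Suc n) \<subseteq> gamma n" using KL_subset_gamma[of "Suc n"] gamma_antimono by blast
  then show ?thesis by blast
qed

text \<open>If \<open>N = \<gamma>\<^sub>n\<close> satisfied \<open>[N, G] = N\<close>, then \<open>N\<close> would descend through the whole filtration \<open>Lev\<close>, so it would fix
every word. But \<open>N\<close> contains some \<open>K\<^sub>k\<close>.\<close>

theorem gamma_strict:
  assumes "n \<ge> 1"
  shows "gamma (Suc n) \<subset> gamma n"
proof (rule ccontr)
  assume "\<not> gamma (Suc n) \<subset> gamma n"
  then have eq: "gamma (Suc n) = gamma n" using gamma_Suc_subset by blast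
  have inL: "gamma n \<subseteq> Lev m i" if "gamma n \<subseteq> Lev m 0" "i \<le> 2 ^ m" for m i
    using that(2)
  proof (induction i)
    case 0
    then show ?case using that by simp
  next
    case (Suc i)
    have ok: "Lev_ok m i" "Lev_ok m (Suc i)" using Suc.prems by (auto intro: Lev_ok)
    have "gamma (Suc n) \<subseteq> Lev m (Suc i)"
    proof (rule gamma_least[OF assms])
      show "subgp (Lev m (Suc i))" using ok by (simp add: Lev_ok_def)
      show "comm x g \<in> Lev m (Suc i)" if "x \<in> gamma n" "g \<in> GG" for x g
      proof -
        have "x \<in> Lev m i" using Suc that by auto
        then show ?thesis using ok(1) Suc.prems that by (simp add: Lev_ok_def)
      qed
    qed
    then show ?case by (simp only: eq)
  qed
  have "gamma n \<subseteq> Lev m 0" for m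
  proof (induction m)
    case 0
    then show ?case using gamma_subset_GG by (simp add: Lev.simps)
  next
    case (Suc m)
    then show ?case using inL[of m "2 ^ m"] Lev_top by blast
  qed
  then have "x = 0" if "x \<in> gamma n" for x
    using that Lev_act[of x] by (intro taut_eqI) auto
  moreover obtain k where "KL k \<subseteq> gamma n" using KL_subset_gamma_ex by blast
  ultimately show False using diag_in_lvl[OF t_in_KK, of k] diag_t_nonzero by blast
qed

section \<open>The index of the lower central subgroups\<close>

definition coset :: "taut set \<Rightarrow> taut \<Rightarrow> taut set" where
  "coset N x = (\<lambda>h. h + x) ` N"

lemma coset_eq_iff:
  assumes "subgp N"
  shows "coset N x = coset N y \<longleftrightarrow> x + - y \<in> N"
proof
  assume "coset N x = coset N y"
  then have "0 + x \<in> coset N y" using subgpD(1)[OF assms] unfolding coset_def by blast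
  then show "x + - y \<in> N" by (auto simp: coset_def add.assoc)
next
  assume xy: "x + - y \<in> N"
  have "h + x \<in> coset N y" if "h \<in> N" for h
    using subgpD(2)[OF assms that xy] unfolding coset_def by (intro image_eqI[of _ _ "h + (x + - y)"]) (simp_all add: add.assoc)
  moreover have "h + y \<in> coset N x" if "h \<in> N" for h
    using subgpD(2)[OF assms that subgpD(3)[OF assms xy]] unfolding coset_def
    by (intro image_eqI[of _ _ "h + - (x + - y)"]) (simp_all add: add.assoc minus_minus)
  ultimately show "coset N x = coset N y" unfolding coset_def by auto
qed

definition cosets :: "taut set \<Rightarrow> taut set set" where
  "cosets N = coset N ` GG"

lemma finite_cosets_gamma: "finite (cosets (gamma n))"
proof -
  obtain k where k: "KL k \<subseteq> gamma n" using KL_subset_gamma_ex by blast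
  obtain F where F: "finite F" "\<forall>x\<in>GG. \<exists>f\<in>F. cong_mod (KL k) f x" using finite_index_KL[of k] by (elim exE conjE)
  have "cosets (gamma n) \<subseteq> coset (gamma n) ` F"
  proof
    fix C assume "C \<in> cosets (gamma n)"
    then obtain x where x: "x \<in> GG" "C = coset (gamma n) x" unfolding cosets_def by blast
    then obtain f where f: "f \<in> F" "- f + x \<in> gamma n" using F(2) k unfolding cong_mod_def by blast
    then have "cj (- x) (- f + x) \<in> gamma n"
      using x subgpD(3)[OF subgp_GG] normalized_byD[OF normalized_gamma] by blast
    then have "x + - f \<in> gamma n" by (simp add: cj_def add.assoc minus_minus)
    then show "C \<in> coset (gamma n) ` F" using x f coset_eq_iff[OF subgp_gamma] by blast
  qed
  then show ?thesis using F(1) finite_surj by blast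
qed

text \<open>For \<open>u\<close> in \<open>M\<close> outside \<open>N\<close>, every coset of \<open>M\<close> with representative \<open>r\<close> contains the two different cosets
of \<open>r\<close> and \<open>u + r\<close>.\<close>

lemma card_cosets_double:
  assumes N: "subgp N" "subgp M" "N \<subset> M" "M \<subseteq> GG" and fin: "finite (cosets N)" 
  shows "2 * card (cosets M) \<le> card (cosets N)"
proof -
  obtain u where u: "u \<in> M" "u \<notin> N" using N by blast
  have "\<forall>C\<in>cosets M. \<exists>r\<in>GG. C = coset M r" unfolding cosets_def by blast
  then obtain r where r: "\<And>C. C \<in> cosets M \<Longrightarrow> r C \<in> GG" "\<And>C. C \<in> cosets M \<Longrightarrow> C = coset M (r C)" by metis
  define \<phi> where "\<phi> = (\<lambda>(C, e). coset N ((if e then u else 0) + r C))"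
  have e_mem: "(if e then u else 0) \<in> M" for e using u subgpD(1)[OF N(2)] by simp
  have "inj_on \<phi> (cosets M \<times> UNIV)"
  proof (rule inj_onI, clarify)
    fix C e C' e'
    assume C: "C \<in> cosets M" "C' \<in> cosets M" and eq: "\<phi> (C, e) = \<phi> (C', e')"
    let ?e = "if e then u else 0" and ?e' = "if e' then u else 0"
    have *: "?e + r C + - (?e' + r C') \<in> N" using eq coset_eq_iff[OF N(1)] by (simp add: \<phi>_def)
    then have "?e + r C + - (?e' + r C') \<in> M" using N(3) by (elim psubsetE subsetD)
    then have "- ?e + (?e + r C + - (?e' + r C')) + ?e' \<in> M"
      by (rule subgpD(2)[OF N(2) subgpD(2)[OF N(2) subgpD(3)[OF N(2) e_mem]] e_mem])
    then have "r C + - r C' \<in> M" by (simp only: minus_add add.assoc minus_add_cancel left_minus add_0_right)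
    then have CC: "C = C'" using r(2) C coset_eq_iff[OF N(2)] by metis
    then have "?e + - ?e' \<in> N" using * by (simp only: minus_add add.assoc add_minus_cancel)
    then have "e = e'" using u(2) subgpD(3)[OF N(1), of "- u"] by (cases e; cases e') (auto simp: minus_minus minus_zero)
    with CC show "C = C' \<and> e = e'" ..
  qed
  moreover have "\<phi> ` (cosets M \<times> UNIV) \<subseteq> cosets N"
  proof clarify
    fix C e assume C: "C \<in> cosets M"
    have "(if e then u else 0) + r C \<in> GG"
      by (rule subgpD(2)[OF subgp_GG subsetD[OF N(4) e_mem] r(1)[OF C]])
    then show "\<phi> (C, e) \<in> cosets N" unfolding \<phi>_def cosets_def by (simp only: prod.case image_eqI)
  qed
  ultimately have "card (cosets M \<times> (UNIV :: bool set)) \<le> card (cosets N)"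
    using fin card_inj_on_le by blast
  then show ?thesis by (simp add: card_cartesian_product mult.commute)
qed

theorem card_cosets_gamma: "2 ^ n \<le> card (cosets (gamma (Suc n)))"
proof (induction n)
  case 0
  have "cosets (gamma (Suc 0)) \<noteq> {}" using gens_in_GG unfolding cosets_def by blast
  then show ?case using finite_cosets_gamma[of "Suc 0"] by (simp add: Suc_leI card_gt_0_iff del: gamma.simps)
next
  case (Suc n)
  have "2 * card (cosets (gamma (Suc n))) \<le> card (cosets (gamma (Suc (Suc n))))"
    by (rule card_cosets_double[OF subgp_gamma subgp_gamma gamma_strict gamma_subset_GG finite_cosets_gamma]) simp
  then show ?case using Suc by simp
qed


section \<open>Back to the group of permutations of words\<close>

lemma carrier_tree_aut: "carrier tree_aut = range act"
proof -
  have "f \<in> range act" if "f \<in> carrier tree_aut" for f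
  proof -
    have "bij f \<and> (\<forall>u v. prefix (f u) (f v) \<longleftrightarrow> prefix u v)"
      using that by (auto simp: tree_aut_def Bij_def)
    then have "act (Taut f) = f" by (simp add: Taut_inverse)
    then show ?thesis by (metis rangeI)
  qed
  moreover have "act x \<in> carrier tree_aut" for x
    using act[of x] by (simp add: tree_aut_def Bij_def)
  ultimately show ?thesis by blast
qed

lemma mult_tree_aut: "act x \<otimes>\<^bsub>tree_aut\<^esub> act y = act (x + y)"
proof -
  have "act z \<in> Bij UNIV" for z using act[of z] by (simp add: Bij_def)
  then show ?thesis by (simp add: tree_aut_def BijGroup_def compose_def fun_eq_iff)
qed

lemma one_tree_aut: "\<one>\<^bsub>tree_aut\<^esub> = act 0"
  by (simp add: tree_aut_def BijGroup_def fun_eq_iff)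

text \<open>A group of permutations whose elements are given as values of type \<open>taut\<close>; it covers both the
full automorphism group and the Grigorchuk group.\<close>

locale taut_group = group G for G :: "(bool list \<Rightarrow> bool list, 'b) monoid_scheme" (structure) +
  fixes A :: "taut set"
  assumes A: "subgp A" and carrier_A: "carrier G = act ` A"
    and mult_act: "\<And>x y. act x \<otimes> act y = act (x + y)" and one_act: "\<one> = act 0"
begin

lemma inv_act: "x \<in> A \<Longrightarrow> inv (act x) = act (- x)"
  by (rule inv_equality) (simp_all add: carrier_A mult_act one_act subgpD[OF A])

lemma generate_act:
  assumes S: "S \<subseteq> A"
  shows "generate G (act ` S) = act ` gen S"
proof
  have genA: "gen S \<subseteq> A" by (rule gen_least[OF A S])
  have SG: "act ` S \<subseteq> carrier G" using S by (auto simp: carrier_A)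
  show "act ` gen S \<subseteq> generate G (act ` S)"
  proof clarify
    fix x assume "x \<in> gen S"
    then show "act x \<in> generate G (act ` S)"
    proof (induction)
      case gen_zero
      then show ?case using generate.one[of G "act ` S"] by (simp only: one_act)
    next
      case (gen_base x)
      then show ?case by (intro generate.incl) simp
    next
      case (gen_plus x y)
      then show ?case using generate.eng[OF gen_plus.IH] by (simp only: mult_act)
    next
      case (gen_minus x)
      then have "inv (act x) \<in> generate G (act ` S)" by (intro generate_m_inv_closed[OF SG])
      then show ?case using gen_minus genA by (simp add: inv_act subset_iff)
    qed
  qed
  show "generate G (act ` S) \<subseteq> act ` gen S"
  proof
    fix f assume "f \<in> generate G (act ` S)"
    then show "f \<in> act ` gen S"
    proof (induction)
      case one
      show ?case unfolding one_act by (blast intro: gen_zero)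
    next
      case (incl h)
      then show ?case by (auto intro: gen_base)
    next
      case (inv h)
      then obtain x where x: "x \<in> S" "h = act x" by blast
      then have "inv h = act (- x)" using S inv_act by blast
      then show ?case using x(1) by (blast intro: gen_base gen_minus)
    next
      case (eng h1 h2)
      then obtain x y where "x \<in> gen S" "y \<in> gen S" "h1 \<otimes> h2 = act (x + y)"
        using mult_act by blast
      then show ?case by (blast intro: gen_plus)
    qed
  qed
qed

end

lemma taut_group_tree_aut: "taut_group tree_aut UNIV"
proof -
  interpret group tree_aut by (rule group_tree_aut)
  show ?thesis
    by unfold_locales (simp_all add: subgpI carrier_tree_aut mult_tree_aut one_tree_aut)
qed

lemma carrier_grigorchuk: "carrier grigorchuk = act ` GG"
proof -
  have "{grig_a, grig_b, grig_c, grig_d} = act ` {a, b, c, d}"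
    by (simp add: a.rep_eq b.rep_eq c.rep_eq d.rep_eq)
  then show ?thesis
    using taut_group.generate_act[OF taut_group_tree_aut, of "{a, b, c, d}"]
    by (simp add: grigorchuk_def GG_def)
qed

interpretation grig: taut_group grigorchuk GG
proof -
  interpret group grigorchuk by (rule group_grigorchuk)
  show "taut_group grigorchuk GG"
    by unfold_locales (simp_all add: subgp_GG carrier_grigorchuk,
        simp_all add: grigorchuk_def mult_tree_aut one_tree_aut)
qed

lemma lower_central_act: "lower_central grigorchuk n = act ` gamma n"
proof (induction n rule: gamma.induct)
  case (3 n)
  let ?X = "{h + k + - h + - k | h k. h \<in> gamma (Suc n) \<and> k \<in> GG}"
  have act: "act h \<otimes>\<^bsub>grigorchuk\<^esub> act k \<otimes>\<^bsub>grigorchuk\<^esub> inv\<^bsub>grigorchuk\<^esub> act h \<otimes>\<^bsub>grigorchuk\<^esub> inv\<^bsub>grigorchuk\<^esub> act k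
      = act (h + k + - h + - k)" if "h \<in> gamma (Suc n)" "k \<in> GG" for h k
    using that gamma_subset_GG[of "Suc n"] by (simp add: grig.inv_act grig.mult_act subset_iff)
  have "lower_central grigorchuk (Suc (Suc n)) = generate grigorchuk (act ` ?X)"
    unfolding lower_central.simps commutator_subgroup_def 3 carrier_grigorchuk
  proof (rule arg_cong[of _ _ "generate grigorchuk"], intro equalityI subsetI)
    fix f assume "f \<in> {h \<otimes>\<^bsub>grigorchuk\<^esub> k \<otimes>\<^bsub>grigorchuk\<^esub> inv\<^bsub>grigorchuk\<^esub> h \<otimes>\<^bsub>grigorchuk\<^esub> inv\<^bsub>grigorchuk\<^esub> k |h k.
      h \<in> act ` gamma (Suc n) \<and> k \<in> act ` GG}"
    then obtain h k where "h \<in> gamma (Suc n)" "k \<in> GG" "f = act (h + k + - h + - k)" using act by auto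
    then show "f \<in> act ` ?X" by blast
  next
    fix f assume "f \<in> act ` ?X"
    then obtain h k where hk: "h \<in> gamma (Suc n)" "k \<in> GG" and f: "f = act (h + k + - h + - k)" by blast
    show "f \<in> {h \<otimes>\<^bsub>grigorchuk\<^esub> k \<otimes>\<^bsub>grigorchuk\<^esub> inv\<^bsub>grigorchuk\<^esub> h \<otimes>\<^bsub>grigorchuk\<^esub> inv\<^bsub>grigorchuk\<^esub> k |h k.
      h \<in> act ` gamma (Suc n) \<and> k \<in> act ` GG}"
      unfolding f act[OF hk, symmetric] using hk by blast
  qed
  also have "\<dots> = act ` gen ?X"
  proof (rule grig.generate_act)
    show "?X \<subseteq> GG" using gamma_subset_GG[of "Suc n"] by (auto intro!: subgpD[OF subgp_GG])
  qed
  finally show ?case by simp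
qed (simp_all add: carrier_grigorchuk)

section \<open>Diameter of the quotients\<close>

abbreviation quot :: "nat \<Rightarrow> (bool list \<Rightarrow> bool list) set monoid" where
  "quot n \<equiv> grigorchuk Mod lower_central grigorchuk n"

definition proj :: "nat \<Rightarrow> taut \<Rightarrow> (bool list \<Rightarrow> bool list) set" where
  "proj n x = act ` coset (gamma n) x"

lemma inj_act: "inj act"
  by (rule injI) (simp add: act_inject)

lemma proj_eq_iff: "proj n x = proj n y \<longleftrightarrow> x + - y \<in> gamma n"
  unfolding proj_def inj_image_eq_iff[OF inj_act] by (rule coset_eq_iff[OF subgp_gamma])

lemma r_coset_act: "lower_central grigorchuk n #>\<^bsub>grigorchuk\<^esub> act x = proj n x"
  by (auto simp: r_coset_def proj_def coset_def lower_central_act grig.mult_act)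

lemma normal_lower_central: "lower_central grigorchuk n \<lhd> grigorchuk"
  unfolding group.normal_inv_iff[OF group_grigorchuk]
proof
  note N = subgpD[OF subgp_gamma[of n]]
  show "subgroup (lower_central grigorchuk n) grigorchuk"
  proof (rule grig.subgroupI)
    show "lower_central grigorchuk n \<subseteq> carrier grigorchuk"
      unfolding lower_central_act carrier_grigorchuk by (rule image_mono[OF gamma_subset_GG])
    show "lower_central grigorchuk n \<noteq> {}" using N(1) by (auto simp: lower_central_act)
    show "inv\<^bsub>grigorchuk\<^esub> f \<in> lower_central grigorchuk n" if "f \<in> lower_central grigorchuk n" for f
      using that N(3) gamma_subset_GG[of n] by (auto simp: lower_central_act grig.inv_act subset_iff)
    show "f \<otimes>\<^bsub>grigorchuk\<^esub> g \<in> lower_central grigorchuk n"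
      if "f \<in> lower_central grigorchuk n" "g \<in> lower_central grigorchuk n" for f g
      using that N(2) by (auto simp: lower_central_act grig.mult_act)
  qed
  show "\<forall>x\<in>carrier grigorchuk. \<forall>h\<in>lower_central grigorchuk n.
      x \<otimes>\<^bsub>grigorchuk\<^esub> h \<otimes>\<^bsub>grigorchuk\<^esub> inv\<^bsub>grigorchuk\<^esub> x \<in> lower_central grigorchuk n"
  proof (intro ballI)
    fix f g assume "f \<in> carrier grigorchuk" "g \<in> lower_central grigorchuk n"
    then obtain x h where xh: "x \<in> GG" "f = act x" "h \<in> gamma n" "g = act h"
      by (auto simp: carrier_grigorchuk lower_central_act)
    have "cj (- x) h \<in> gamma n" using xh normalized_byD[OF normalized_gamma] subgpD(3)[OF subgp_GG] by blast
    then show "f \<otimes>\<^bsub>grigorchuk\<^esub> g \<otimes>\<^bsub>grigorchuk\<^esub> inv\<^bsub>grigorchuk\<^esub> f \<in> lower_central grigorchuk n"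
      using xh by (simp add: grig.mult_act grig.inv_act lower_central_act cj_def minus_minus)
  qed
qed

lemma carrier_quot: "carrier (quot n) = proj n ` GG"
  by (auto simp: FactGroup_def RCOSETS_def carrier_grigorchuk r_coset_act)

lemma rcosets_lower_central: "rcosets\<^bsub>grigorchuk\<^esub> lower_central grigorchuk n = (`) act ` cosets (gamma n)"
  by (auto simp: RCOSETS_def carrier_grigorchuk r_coset_act cosets_def proj_def)

lemma card_rcosets: "card (rcosets\<^bsub>grigorchuk\<^esub> lower_central grigorchuk n) = card (cosets (gamma n))"
  unfolding rcosets_lower_central
  by (rule card_image) (auto intro!: inj_onI simp: inj_image_eq_iff[OF inj_act])

lemma finite_carrier_quot: "finite (carrier (quot n))"
  unfolding FactGroup_def using finite_cosets_gamma by (simp add: rcosets_lower_central)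

lemma group_quot: "group (quot n)"
  by (rule normal.factorgroup_is_group[OF normal_lower_central])

lemma mult_quot: "x \<in> GG \<Longrightarrow> y \<in> GG \<Longrightarrow> proj n x \<otimes>\<^bsub>quot n\<^esub> proj n y = proj n (x + y)"
  using normal.rcos_sum[OF normal_lower_central, of "act x" "act y" n]
  by (simp add: FactGroup_def r_coset_act carrier_grigorchuk grig.mult_act)

lemma one_quot: "\<one>\<^bsub>quot n\<^esub> = proj n 0"
  by (simp add: FactGroup_def proj_def coset_def lower_central_act)

lemma inv_quot: "x \<in> GG \<Longrightarrow> inv\<^bsub>quot n\<^esub> (proj n x) = proj n (- x)"
proof (rule group.inv_equality[OF group_quot])
  assume x: "x \<in> GG"
  then have mx: "- x \<in> GG" by (rule subgpD[OF subgp_GG])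
  show "proj n (- x) \<otimes>\<^bsub>quot n\<^esub> proj n x = \<one>\<^bsub>quot n\<^esub>"
    unfolding mult_quot[OF mx x] one_quot by simp
  show "proj n x \<in> carrier (quot n)" "proj n (- x) \<in> carrier (quot n)"
    using x mx by (auto simp: carrier_quot)
qed

lemma diam_le:
  assumes fin: "finite (carrier Q)" and G: "group Q"
    and S: "\<And>S. S \<subseteq> carrier Q \<Longrightarrow> generate Q S = carrier Q \<Longrightarrow> carrier Q \<subseteq> word_ball Q S L"
  shows "diam Q \<le> L"
proof -
  interpret group Q by (rule G)
  have bound: "diam_wrt Q S \<le> L" if SQ: "S \<subseteq> carrier Q" "generate Q S = carrier Q" for S
  proof -
    have "foldr (\<otimes>\<^bsub>Q\<^esub>) ws \<one>\<^bsub>Q\<^esub> \<in> carrier Q" if "set ws \<subseteq> S \<union> set_inv\<^bsub>Q\<^esub> S" for ws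
      using that SQ(1) by (induction ws) (auto simp: SET_INV_def)
    then have "word_ball Q S L \<subseteq> carrier Q" by (auto simp: word_ball_def)
    then have "word_ball Q S L = carrier Q" using S SQ by blast
    then show ?thesis unfolding diam_wrt_def by (rule Least_le)
  qed
  let ?D = "{diam_wrt Q S | S. S \<subseteq> carrier Q \<and> generate Q S = carrier Q}"
  have "generate Q (carrier Q) = carrier Q"
    using generate_incl[of "carrier Q"] generate.incl[of _ "carrier Q" Q] by blast
  then have "?D \<noteq> {}" by blast
  moreover have "finite ?D"
    by (rule finite_subset[of _ "diam_wrt Q ` Pow (carrier Q)"]) (use fin in auto)
  ultimately show ?thesis unfolding diam_def using bound by (intro Max.boundedI) auto
qed

text \<open>A generating set \<open>S\<close> of the quotient is lifted to its full preimage \<open>T\<close> together with \<open>\<gamma>\<^sub>n\<close>, which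
generates \<open>G\<close>. A word in \<open>T\<close> projects to a word in \<open>S\<close> of at most the same length, because the letters from
\<open>\<gamma>\<^sub>n\<close> may be dropped.\<close>

lemma diam_quot_le:
  assumes approx: "\<And>S x. S \<subseteq> GG \<Longrightarrow> gen S = GG \<Longrightarrow> x \<in> GG \<Longrightarrow> \<exists>w\<in>ball S L. cong_mod (gamma n) w x"
  shows "diam (quot n) \<le> L"
proof (rule diam_le[OF finite_carrier_quot group_quot])
  fix S assume S: "S \<subseteq> carrier (quot n)" "generate (quot n) S = carrier (quot n)"
  interpret Q: group "quot n" by (rule group_quot)
  \<comment> \<open>\<open>gamma n\<close> is added for the case that \<open>S\<close> is empty\<close>
  define T where "T = {x \<in> GG. proj n x \<in> S} \<union> gamma n"
  have T: "T \<subseteq> GG" using gamma_subset_GG by (auto simp: T_def)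
  have genT: "gen T \<subseteq> GG" by (rule gen_least[OF subgp_GG T])
  have lift: "X \<in> proj n ` gen T" if "X \<in> generate (quot n) S" for X
    using that
  proof (induction)
    case one
    show ?case unfolding one_quot by (blast intro: gen_zero)
  next
    case (incl X)
    then show ?case using S(1) by (auto simp: carrier_quot T_def intro!: gen_base)
  next
    case (inv X)
    then obtain x where x: "x \<in> GG" "X = proj n x" "x \<in> T" using S(1) by (auto simp: carrier_quot T_def)
    then show ?case using inv_quot by (auto intro: gen.intros)
  next
    case (eng X Y)
    then obtain x y where "x \<in> gen T" "y \<in> gen T" "X = proj n x" "Y = proj n y" by blast
    then show ?case using mult_quot genT gen_plus by (metis imageI subsetD)
  qed
  have "GG \<subseteq> gen T"
  proof
    fix x assume x: "x \<in> GG"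
    then have "proj n x \<in> proj n ` gen T" using lift S(2) by (simp add: carrier_quot)
    then obtain y where y: "y \<in> gen T" "x + - y \<in> gamma n" by (auto simp: proj_eq_iff)
    then have "x + - y \<in> gen T" by (intro gen_base) (simp add: T_def)
    then have "(x + - y) + y \<in> gen T" using y(1) by (rule gen_plus)
    then show "x \<in> gen T" by (simp add: add.assoc)
  qed
  then have genT': "gen T = GG" using genT by blast
  have words: "\<exists>vs. set vs \<subseteq> S \<union> set_inv\<^bsub>quot n\<^esub> S \<and> length vs \<le> length ws \<and>
      foldr (\<otimes>\<^bsub>quot n\<^esub>) vs \<one>\<^bsub>quot n\<^esub> = proj n (sum_list ws) \<and> sum_list ws \<in> GG"
    if "set ws \<subseteq> T \<union> uminus ` T" for ws
    using that
  proof (induction ws)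
    case Nil
    then show ?case by (intro exI[of _ "[]"]) (simp add: one_quot[symmetric] subgpD[OF subgp_GG])
  next
    case (Cons u ws)
    then obtain vs where vs: "set vs \<subseteq> S \<union> set_inv\<^bsub>quot n\<^esub> S" "length vs \<le> length ws"
      "foldr (\<otimes>\<^bsub>quot n\<^esub>) vs \<one>\<^bsub>quot n\<^esub> = proj n (sum_list ws)" "sum_list ws \<in> GG" by auto
    have u: "u \<in> GG" using Cons.prems T subgpD(3)[OF subgp_GG] by auto
    have sum: "sum_list (u # ws) \<in> GG" using u vs(4) subgpD(2)[OF subgp_GG] by simp
    consider "u \<in> gamma n" | "proj n u \<in> S \<union> set_inv\<^bsub>quot n\<^esub> S"
    proof -
      have "u \<in> gamma n \<or> proj n u \<in> S \<or> (\<exists>v\<in>GG. proj n v \<in> S \<and> u = - v)"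
        using Cons.prems subgpD(3)[OF subgp_gamma] by (auto simp: T_def)
      then show thesis
      proof (elim disjE bexE conjE)
        fix v assume v: "v \<in> GG" "proj n v \<in> S" "u = - v"
        then have "proj n u = inv\<^bsub>quot n\<^esub> (proj n v)" by (simp add: inv_quot)
        then show thesis using v(2) that(2) by (auto simp: SET_INV_def)
      qed (use that in auto)
    qed
    then show ?case
    proof cases
      case 1
      then have "proj n (sum_list (u # ws)) = proj n (sum_list ws)"
        by (simp add: proj_eq_iff add.assoc)
      then show ?thesis using vs sum by (intro exI[of _ vs]) simp
    next
      case 2
      then show ?thesis using vs sum u mult_quot[OF u vs(4)] by (intro exI[of _ "proj n u # vs"]) simp
    qed
  qed
  show "carrier (quot n) \<subseteq> word_ball (quot n) S L"
  proof
    fix X assume "X \<in> carrier (quot n)"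
    then obtain x where x: "x \<in> GG" "X = proj n x" by (auto simp: carrier_quot)
    then obtain w where w: "w \<in> ball T L" "- w + x \<in> gamma n" using approx[OF T genT'] unfolding cong_mod_def by blast
    have "cj (- x) (- w + x) \<in> gamma n"
      using x subgpD(3)[OF subgp_GG] w(2) normalized_byD[OF normalized_gamma] by blast
    then have X: "X = proj n w" unfolding x(2) proj_eq_iff by (simp add: cj_def add.assoc minus_minus)
    obtain ws where ws: "w = sum_list ws" "set ws \<subseteq> T \<union> uminus ` T" "length ws \<le> L"
      using w(1) unfolding ball_def by blast
    then obtain vs where "set vs \<subseteq> S \<union> set_inv\<^bsub>quot n\<^esub> S" "length vs \<le> length ws"
      "foldr (\<otimes>\<^bsub>quot n\<^esub>) vs \<one>\<^bsub>quot n\<^esub> = X" using words X by blast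
    then show "X \<in> word_ball (quot n) S L" unfolding word_ball_def using ws(3) by fastforce
  qed
qed

text \<open>Arithmetic on numbers prefers differences again.\<close>

declare add_uminus_conv_diff [simp] diff_conv_add_uminus [simp del] minus_add [simp del]

text \<open>With \<open>8\<^sup>k \<le> n < 8\<^bsup>k+1\<^esup>\<close> the subgroup \<open>K\<^bsub>3(k+2)\<^esub>\<close> lies in \<open>\<gamma>\<^sub>n\<close>, and \<open>35\<^bsup>3(k+2)\<^esup>\<close> is the power of \<open>8\<^bsup>k+2\<^esup>\<close>, hence
at most that of \<open>64 n\<close>, with exponent \<open>log 35 / log 2\<close>.\<close>

lemma diam_quot_bound:
  "\<exists>C>0. \<forall>n\<ge>1. real (diam (quot n)) \<le> C * real n powr (ln 35 / ln 2)"
proof -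
  obtain C where C: "\<And>S n x. S \<subseteq> GG \<Longrightarrow> gen S = GG \<Longrightarrow> x \<in> GG \<Longrightarrow> \<exists>w\<in>ball S (C * 35 ^ n). cong_mod (KL n) w x"
    using uniform_approximation by (elim exE) blast
  let ?e = "ln 35 / ln 2 :: real"
  \<comment> \<open>this identity is where the exponent comes from\<close>
  have two: "2 powr ?e = (35 :: real)" by (simp add: powr_def)
  have "real (diam (quot n)) \<le> (real C + 1) * 64 powr ?e * real n powr ?e" if n: "n \<ge> 1" for n
  proof -
    obtain k where k: "8 ^ k \<le> n" "n < 8 ^ (k + 1)" using ex_power_ivl1[of 8 n] n by auto
    have "n \<le> 8 ^ (k + 2) div 8 + 1" using k(2) by simp
    then have sub: "KL (3 * (k + 2)) \<subseteq> gamma n" using KL_subset_gamma gamma_antimono by blast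
    have "diam (quot n) \<le> C * 35 ^ (3 * (k + 2))"
    proof (rule diam_quot_le)
      fix S x assume "S \<subseteq> GG" "gen S = GG" "x \<in> GG"
      then obtain w where "w \<in> ball S (C * 35 ^ (3 * (k + 2)))" "cong_mod (KL (3 * (k + 2))) w x" using C by blast
      then show "\<exists>w\<in>ball S (C * 35 ^ (3 * (k + 2))). cong_mod (gamma n) w x" using cong_mono[OF _ sub] by blast
    qed
    then have "real (diam (quot n)) \<le> real (C * 35 ^ (3 * (k + 2)))" by (rule of_nat_mono)
    also have "\<dots> = real C * 35 ^ (3 * (k + 2))" by simp
    also have "(35 :: real) ^ (3 * (k + 2)) = (64 * 8 ^ k) powr ?e"
    proof -
      have "(35 :: real) ^ (3 * (k + 2)) = (2 powr ?e) powr real (3 * (k + 2))"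
        unfolding two by (rule powr_realpow[symmetric]) simp
      also have "\<dots> = (2 powr real (3 * (k + 2))) powr ?e" by (simp only: powr_powr mult.commute)
      also have "2 powr real (3 * (k + 2)) = (2 :: real) ^ (3 * (k + 2))" by (rule powr_realpow) simp
      also have "(2 :: real) ^ (3 * (k + 2)) = 64 * 8 ^ k" by (simp add: power_add power_mult)
      finally show ?thesis .
    qed
    also have "\<dots> \<le> (64 * real n) powr ?e"
    proof (rule powr_mono2)
      have "real (8 ^ k) \<le> real n" using k(1) by (rule of_nat_mono)
      then show "64 * 8 ^ k \<le> 64 * real n" by simp
    qed simp_all
    also have "(64 * real n) powr ?e = 64 powr ?e * real n powr ?e" by (rule powr_mult)
    finally have "real (diam (quot n)) \<le> real C * (64 powr ?e * real n powr ?e)"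
      by (simp add: mult_left_mono)
    also have "\<dots> \<le> (real C + 1) * (64 powr ?e * real n powr ?e)" by (intro mult_right_mono) simp_all
    finally show ?thesis by (simp add: mult.assoc)
  qed
  then show ?thesis by (intro exI[of _ "(real C + 1) * 64 powr ?e"]) simp
qed

text \<open>The logarithm of the index vanishes for \<open>n = 1\<close>, so here the diameter has to vanish too.\<close>

lemma diam_quot_1: "diam (quot 1) = 0"
proof -
  have "diam (quot 1) \<le> 0"
  proof (rule diam_quot_le)
    fix S x assume "x \<in> GG"
    then show "\<exists>w\<in>ball S 0. cong_mod (gamma 1) w x"
      using ball_zero by (intro bexI[of _ 0]) (auto simp: cong_mod_def minus_zero)
  qed
  then show ?thesis by simp
qed

lemma index_bound:
  assumes "n \<ge> 2"
  shows "real n \<le> 2 / ln 2 * ln (real (card (rcosets\<^bsub>grigorchuk\<^esub> lower_central grigorchuk n)))"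
proof -
  have n: "n = Suc (n - 1)" using assms by simp
  have "2 ^ (n - 1) \<le> card (cosets (gamma n))" using card_cosets_gamma[of "n - 1"] n by simp
  then have "real (2 ^ (n - 1)) \<le> real (card (cosets (gamma n)))" by (rule of_nat_mono)
  then have "ln (2 ^ (n - 1)) \<le> ln (real (card (cosets (gamma n))))" by (simp add: ln_mono)
  then have "real (n - 1) * ln 2 \<le> ln (real (card (cosets (gamma n))))" by (simp add: ln_realpow)
  moreover have "real n / 2 * ln 2 \<le> real (n - 1) * ln 2"
    using assms by (intro mult_right_mono) (auto simp: of_nat_diff)
  ultimately have "real n / 2 * ln 2 \<le> ln (real (card (cosets (gamma n))))" by linarith
  then show ?thesis by (simp add: card_rcosets field_simps)
qed

theorem theorem1p2:
  shows "(\<forall>n\<ge>1. finite (carrier (grigorchuk Mod lower_central grigorchuk n)))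
    \<and> (\<exists>C>0::real. \<forall>n\<ge>1.
          real (diam (grigorchuk Mod lower_central grigorchuk n))
            \<le> C * real n powr (ln 35 / ln 2))
    \<and> (\<exists>C>0::real. \<forall>n\<ge>1.
          real (diam (grigorchuk Mod lower_central grigorchuk n))
            \<le> C * ln (real (card (rcosets\<^bsub>grigorchuk\<^esub> lower_central grigorchuk n)))
                  powr (ln 35 / ln 2))"
proof (intro conjI)
  show "\<forall>n\<ge>1. finite (carrier (quot n))" using finite_carrier_quot by blast
  show 1: "\<exists>C>0. \<forall>n\<ge>1. real (diam (quot n)) \<le> C * real n powr (ln 35 / ln 2)"
    by (rule diam_quot_bound)
  let ?e = "ln 35 / ln 2 :: real"
  let ?I = "\<lambda>n. ln (real (card (rcosets\<^bsub>grigorchuk\<^esub> lower_central grigorchuk n)))"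
  obtain C where C: "C > 0" "\<And>n. n \<ge> 1 \<Longrightarrow> real (diam (quot n)) \<le> C * real n powr ?e"
    using 1 by blast
  have "real (diam (quot n)) \<le> C * (2 / ln 2) powr ?e * ?I n powr ?e" if "n \<ge> 1" for n
  proof (cases "n = 1")
    case True
    then show ?thesis using C(1) diam_quot_1 by simp
  next
    case False
    then have n: "real n \<le> 2 / ln 2 * ?I n" using that by (intro index_bound) simp
    have "real n powr ?e \<le> (2 / ln 2 * ?I n) powr ?e" using n by (intro powr_mono2) simp_all
    also have "\<dots> = (2 / ln 2) powr ?e * ?I n powr ?e" by (rule powr_mult)
    finally have "C * real n powr ?e \<le> C * ((2 / ln 2) powr ?e * ?I n powr ?e)"
      using C(1) by (intro mult_left_mono) simp_all
    then show ?thesis using C(2)[OF that] by (simp add: mult.assoc)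
  qed
  then show "\<exists>C>0. \<forall>n\<ge>1. real (diam (quot n)) \<le> C * ?I n powr ?e"
    using C(1) by (intro exI[of _ "C * (2 / ln 2) powr ?e"]) simp
qed

end
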